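(* Let $G$ be a $3$-connected graph and let $e=u_1u_2$ be an edge of $G$. Then $G$ contains no pair of edge-disjoint cycles whose union contains $e$ if and only if $G$ has internally disjoint $(u_1,u_2)$-paths $\alpha=u_1,v_1,\dots,v_n,u_2$ and $\beta=u_1,w_1,\dots,w_n,u_2$, neither containing $e$, and there is a family $\mathcal P$ of pairwise disjoint pairs $\{i,i+1\}$ of consecutive elements of $\{1,\dots,n\}$ such that (a) $V(G)=V(\alpha)\cup V(\beta)$, and (b) $E(G)=\{v_iw_j,\ v_jw_i:\{i,j\}\in\mathcal P\}\cup\{v_kw_k: k \text{ belongs to no member of } \mathcal P\}\cup E(\alpha)\cup E(\beta)\cup\{e\}$.
   Context: Graphs are finite, without loops or parallel edges. "A pair of edge-disjoint cycles whose union contains $e$" means two cycles with no common edge, one of which contains the edge $e$. *)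

theory Defs
  imports Main
begin

definition simple_graph :: "'a set \<Rightarrow> 'a set set \<Rightarrow> bool" where
  "simple_graph V E \<longleftrightarrow> finite V \<and> (\<forall>e\<in>E. e \<subseteq> V \<and> card e = 2)"

fun path_edges :: "'a list \<Rightarrow> 'a set set" where
  "path_edges (x # y # zs) = insert {x, y} (path_edges (y # zs))"
| "path_edges _ = {}"

definition is_path :: "'a set \<Rightarrow> 'a set set \<Rightarrow> 'a \<Rightarrow> 'a list \<Rightarrow> 'a \<Rightarrow> bool" where
  "is_path V E x p y \<longleftrightarrow>
     p \<noteq> [] \<and> hd p = x \<and> last p = y \<and> distinct p \<and> set p \<subseteq> V \<and> path_edges p \<subseteq> E"

text \<open>A cycle is given by the list of its vertices, without repeating the first one at the end.\<close>

definition cycle_edges :: "'a list \<Rightarrow> 'a set set" where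
  "cycle_edges c = path_edges (c @ [hd c])"

definition is_cycle :: "'a set \<Rightarrow> 'a set set \<Rightarrow> 'a list \<Rightarrow> bool" where
  "is_cycle V E c \<longleftrightarrow> 3 \<le> length c \<and> distinct c \<and> set c \<subseteq> V \<and> cycle_edges c \<subseteq> E"

definition connected_graph :: "'a set \<Rightarrow> 'a set set \<Rightarrow> bool" where
  "connected_graph V E \<longleftrightarrow> V \<noteq> {} \<and> (\<forall>x\<in>V. \<forall>y\<in>V. \<exists>p. is_path V E x p y)"

definition k_connected :: "nat \<Rightarrow> 'a set \<Rightarrow> 'a set set \<Rightarrow> bool" where
  "k_connected k V E \<longleftrightarrow>
     k < card V \<and>
     (\<forall>X \<subseteq> V. card X < k \<longrightarrow> connected_graph (V - X) {e \<in> E. e \<inter> X = {}})"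

end

theory Submission
  imports Defs
begin

text \<open>
  If no cycle is edge-disjoint from a cycle through \<open>e\<close>, then deleting the edges of any \<open>u\<^sub>1\<close>-\<open>u\<^sub>2\<close>
  path from \<open>G - e\<close> leaves a forest. As \<open>G - e\<close> is 2-connected, it has two internally disjoint
  such paths \<open>\<alpha>\<close> and \<open>\<beta>\<close>. The edges on neither path form a forest each of whose components
  meets \<open>\<alpha>\<close> at most once and \<open>\<beta>\<close> at most once, since otherwise deleting the other path would
  leave a cycle. All leaves of this forest lie on the paths because the minimum degree is 3, so every
  component has at most two leaves, and the edges off the paths form a perfect matching \<open>\<pi>\<close> between
  the interiors of \<open>\<alpha>\<close> and \<open>\<beta>\<close>. A matching edge that moves an index by more than one leaves room
  for a cycle beside the path using that edge, so \<open>\<pi>\<close> is a product of disjoint adjacent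
  transpositions.

  Conversely, cut the ladder between levels \<open>k\<close> and \<open>k + 1\<close>. The path \<open>C - e\<close> crosses every cut, and
  a cycle \<open>D\<close> never crosses a cut exactly once. A cut consists of two edges, which leaves none for \<open>D\<close>,
  or of the four edges of a crossed pair of rungs, of which \<open>D\<close> would need all four.
\<close>

subsection \<open>Linkage and forests\<close>

lemma path_edges_append:
  "path_edges (xs @ y # ys) = path_edges (xs @ [y]) \<union> path_edges (y # ys)"
proof (induction xs)
  case (Cons x xs)
  then show ?case by (cases xs) auto
qed simp

lemma path_edges_rev: "path_edges (rev p) = path_edges p"
proof (induction p rule: path_edges.induct)
  case (1 x y zs)
  have "path_edges (rev zs @ y # [x]) = path_edges (rev zs @ [y]) \<union> {{x, y}}"
    by (subst path_edges_append) (auto simp: insert_commute)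
  with 1 show ?case by auto
qed auto

lemma path_edges_nth: "path_edges p = {{p ! i, p ! Suc i} | i. Suc i < length p}"
proof (induction p rule: path_edges.induct)
  case (1 x y zs)
  have "{{(x # y # zs) ! i, (x # y # zs) ! Suc i} | i. Suc i < length (x # y # zs)} =
    insert {x, y} {{(y # zs) ! i, (y # zs) ! Suc i} | i. Suc i < length (y # zs)}"
    (is "?L = ?R")
  proof (rule equalityI; rule subsetI)
    fix f assume "f \<in> ?L"
    then obtain i where "f = {(x # y # zs) ! i, (x # y # zs) ! Suc i}" "Suc i < length (x # y # zs)"
      by blast
    then show "f \<in> ?R" by (cases i) auto
  next
    fix f assume "f \<in> ?R"
    then consider "f = {x, y}" | i where "f = {(y # zs) ! i, (y # zs) ! Suc i}" "Suc i < length (y # zs)"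
      by blast
    then show "f \<in> ?L"
    proof cases
      case 1
      then show ?thesis by (intro CollectI exI[of _ 0]) auto
    next
      case (2 i)
      then show ?thesis by (intro CollectI exI[of _ "Suc i"]) auto
    qed
  qed
  with 1 show ?case by simp
qed auto

lemma path_edges_subset: "f \<in> path_edges p \<Longrightarrow> f \<subseteq> set p"
  by (induction p rule: path_edges.induct) auto

lemma set_subset_Union_path_edges:
  assumes "2 \<le> length p" shows "set p \<subseteq> \<Union>(path_edges p)"
  using assms
proof (induction p rule: path_edges.induct)
  case (1 x y zs)
  then show ?case by (cases zs) auto
qed auto

definition nbrs :: "'a set set \<Rightarrow> 'a \<Rightarrow> 'a set" where
  "nbrs S x = {y. {x, y} \<in> S}"

lemma card_nbrs_path_edges:
  assumes "distinct p" shows "card (nbrs (path_edges p) x) \<le> 2"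
proof (cases "x \<in> set p")
  case True
  then obtain i where i: "i < length p" "x = p ! i" by (metis in_set_conv_nth)
  \<comment> \<open>At the front \<open>i - 1\<close> is again \<open>i\<close>, and
    \<open>p ! Suc i\<close> may lie past the end; both are harmless, because only an upper bound is
    wanted.\<close>
  have "nbrs (path_edges p) x \<subseteq> {p ! (i - 1), p ! Suc i}"
    using assms i by (auto simp: nbrs_def path_edges_nth doubleton_eq_iff nth_eq_iff_index_eq)
  then have "card (nbrs (path_edges p) x) \<le> card {p ! (i - 1), p ! Suc i}"
    by (intro card_mono) auto
  also have "\<dots> \<le> 2" by (simp add: card_insert_if)
  finally show ?thesis .
next
  case False
  then have "nbrs (path_edges p) x = {}" by (auto simp: nbrs_def dest: path_edges_subset)
  then show ?thesis by simp
qed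

text \<open>Connectivity depends on the edge set alone, so deleting edges is set difference and
  deleting a vertex means dropping the edges at it. Every point is linked to itself, even if no edge
  touches it.\<close>

definition linked :: "'a set set \<Rightarrow> 'a \<Rightarrow> 'a \<Rightarrow> bool" where
  "linked S = (\<lambda>a b. {a, b} \<in> S)\<^sup>*\<^sup>*"

lemma linked_refl [simp]: "linked S a a"
  by (simp add: linked_def)

lemma linked_edge: "{a, b} \<in> S \<Longrightarrow> linked S a b"
  by (auto simp: linked_def)

lemma linked_trans [trans]: "linked S a b \<Longrightarrow> linked S b c \<Longrightarrow> linked S a c"
  by (simp add: linked_def)

lemma linked_sym: "linked S a b \<Longrightarrow> linked S b a"
  unfolding linked_def
proof (induction rule: rtranclp_induct)
  case (step y z)
  then have "{z, y} \<in> S" by (simp add: insert_commute)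
  with step show ?case by (metis (mono_tags, lifting) converse_rtranclp_into_rtranclp)
qed simp

lemma linked_mono: "linked S a b \<Longrightarrow> S \<subseteq> T \<Longrightarrow> linked T a b"
  unfolding linked_def by (erule rtranclp_mono[THEN predicate2D, rotated]) auto

lemma linked_path_edges: "p \<noteq> [] \<Longrightarrow> linked (path_edges p) (hd p) (last p)"
proof (induction p rule: path_edges.induct)
  case (1 x y zs)
  have "linked (path_edges (x # y # zs)) x y" by (rule linked_edge) simp
  also have "linked (path_edges (x # y # zs)) y (last (y # zs))"
    using 1 by (auto intro: linked_mono)
  finally show ?case by simp
qed auto

lemma linked_crossing_edge:
  assumes "linked S a b" "a \<in> X" "b \<notin> X"
  obtains c d where "{c, d} \<in> S" "c \<in> X" "d \<notin> X"
proof -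
  have "\<exists>c d. {c, d} \<in> S \<and> c \<in> X \<and> d \<notin> X"
    using assms unfolding linked_def by (induction rule: rtranclp_induct) auto
  with that show ?thesis by blast
qed

text \<open>A walk that uses the deleted edge passes through its end \<open>p\<close>. The second
  alternative keeps the edge, so nothing has to be said about when it is first used.\<close>

lemma linked_Diff_edge:
  assumes "linked S a b" shows "linked (S - {{p, q}}) a b \<or> linked S a p"
  using assms unfolding linked_def
proof (induction rule: rtranclp_induct)
  case (step y z)
  show ?case
  proof (cases "{y, z} = {p, q}")
    case True
    then have "y = p \<or> z = p" by (auto simp: doubleton_eq_iff)
    moreover have "(\<lambda>a b. {a, b} \<in> S)\<^sup>*\<^sup>* a z" using step.hyps by (simp add: rtranclp.rtrancl_into_rtrancl)
    ultimately show ?thesis using step.hyps by blast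
  next
    case False
    then have "(\<lambda>a b. {a, b} \<in> S - {{p, q}}) y z" using step.hyps by simp
    with step.IH show ?thesis by (meson rtranclp.rtrancl_into_rtrancl)
  qed
qed simp

text \<open>The path is built from its far end. A new first vertex in \<open>Z\<close> replaces the
  whole path, one that already occurs cuts the path down to the suffix starting there, and any other
  is prepended.\<close>

lemma linked_first_hit:
  assumes "linked S a t" "t \<in> Z"
  obtains p where "p \<noteq> []" "hd p = a" "last p \<in> Z" "set (butlast p) \<inter> Z = {}" "distinct p"
    "path_edges p \<subseteq> S"
proof -
  have "\<exists>p. p \<noteq> [] \<and> hd p = a \<and> last p \<in> Z \<and> set (butlast p) \<inter> Z = {} \<and> distinct p \<and> path_edges p \<subseteq> S"
    using assms(1) unfolding linked_def
  proof (induction rule: converse_rtranclp_induct)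
    case base
    show ?case using assms(2) by (intro exI[of _ "[t]"]) auto
  next
    case (step y z)
    then obtain p where p: "p \<noteq> []" "hd p = z" "last p \<in> Z" "set (butlast p) \<inter> Z = {}" "distinct p"
      "path_edges p \<subseteq> S" by blast
    consider "y \<in> Z" | "y \<notin> Z" "y \<in> set p" | "y \<notin> Z" "y \<notin> set p" by blast
    then show ?case
    proof cases
      case 1
      then show ?thesis by (intro exI[of _ "[y]"]) auto
    next
      case 2
      then obtain xs ys where xs: "p = xs @ y # ys" by (metis split_list)
      have "path_edges (y # ys) \<subseteq> S" using p(6) unfolding xs by (subst (asm) path_edges_append) auto
      then show ?thesis using p xs
        by (intro exI[of _ "y # ys"]) (auto simp: butlast_append split: if_splits)
    next
      case 3
      have "path_edges (y # p) \<subseteq> S" using p step.hyps by (cases p) auto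
      then show ?thesis using p 3 by (intro exI[of _ "y # p"]) auto
    qed
  qed
  with that show ?thesis by blast
qed

lemma linked_path:
  assumes "linked S a b"
  obtains p where "p \<noteq> []" "hd p = a" "last p = b" "distinct p" "path_edges p \<subseteq> S"
  using linked_first_hit[OF assms, of "{b}"] by auto

text \<open>Acyclicity in the form that every edge is a bridge, so that cycle lists can be avoided.
  Singleton members of \<open>S\<close> are exempt.\<close>

definition forest :: "'a set set \<Rightarrow> bool" where
  "forest S \<longleftrightarrow> (\<forall>a b. a \<noteq> b \<longrightarrow> {a, b} \<in> S \<longrightarrow> \<not> linked (S - {{a, b}}) a b)"

lemma forest_subset: "forest T \<Longrightarrow> S \<subseteq> T \<Longrightarrow> forest S"
  unfolding forest_def by (meson Diff_mono linked_mono order_refl subsetD)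

lemma forestD: "forest S \<Longrightarrow> {a, b} \<in> S \<Longrightarrow> a \<noteq> b \<Longrightarrow> \<not> linked (S - {{a, b}}) a b"
  by (simp add: forest_def)

text \<open>Otherwise the first edge of an \<open>S\<close>-path from \<open>x\<close> to
  \<open>z\<close> is bypassed by a walk through \<open>T\<close> followed by the rest of the path
  backwards. With a path as \<open>T\<close>, a component of \<open>S\<close> meets that path at
  most once.\<close>

lemma forest_linked_unique:
  assumes "forest (S \<union> T)" "S \<inter> T = {}" "linked S x z" "linked T x z"
  shows "x = z"
proof (rule ccontr)
  assume "x \<noteq> z"
  obtain p where p: "p \<noteq> []" "hd p = x" "last p = z" "distinct p" "path_edges p \<subseteq> S"
    using linked_path[OF assms(3)] .
  obtain y ys where ys: "p = x # y # ys"
    using p(1-3) \<open>x \<noteq> z\<close> by (metis last_ConsL list.exhaust_sel)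
  let ?U = "S \<union> T - {{x, y}}"
  have "{x, y} \<in> S" using p ys by simp
  have "linked ?U x z"
    using assms(2,4) \<open>{x, y} \<in> S\<close> by (auto elim!: linked_mono)
  moreover have "{x, y} \<notin> path_edges (y # ys)"
    using p(4) ys path_edges_subset by fastforce
  then have "linked ?U y z"
    using linked_path_edges[of "y # ys"] p ys by (auto elim!: linked_mono)
  ultimately have "linked ?U x y" using linked_sym linked_trans by metis
  moreover have "x \<noteq> y" using p ys by auto
  ultimately show False using assms(1) \<open>{x, y} \<in> S\<close> forestD[of "S \<union> T" x y] by simp
qed

text \<open>If the branches behind \<open>y\<close> and \<open>y'\<close> shared \<open>z\<close>,
  the walk from \<open>x\<close> over \<open>y\<close> and \<open>z\<close> to \<open>y'\<close>
  would bypass the edge to \<open>y'\<close>. Hence leaves found in different branches at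
  \<open>x\<close> are different.\<close>

lemma forest_branches_disjoint:
  assumes "forest S" "{x, y} \<in> S" "{x, y'} \<in> S" "x \<noteq> y" "x \<noteq> y'" "y \<noteq> y'"
    and "linked (S - {{x, y}}) y z" "linked (S - {{x, y'}}) y' z"
  shows False
proof -
  have "\<not> linked (S - {{x, y}}) y x" using forestD assms linked_sym by metis
  \<comment> \<open>A walk from \<open>y\<close> to \<open>z\<close> using the edge
    \<open>{x, y'}\<close> would reach \<open>x\<close> without \<open>{x, y}\<close>, which is a
    bridge.\<close>
  then have "linked (S - {{x, y}} - {{x, y'}}) y z"
    using linked_Diff_edge[OF assms(7)] by blast
  then have "linked (S - {{x, y'}}) y z" by (rule linked_mono) auto
  moreover have "linked (S - {{x, y'}}) x y"
    using assms by (intro linked_edge) (auto simp: doubleton_eq_iff)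
  ultimately have "linked (S - {{x, y'}}) x y'"
    using assms(8) linked_sym linked_trans by metis
  then show False using forestD assms by metis
qed

text \<open>Walking away from \<open>x\<close> ends in a leaf: either \<open>y\<close> is one, or
  the edge \<open>{x, y}\<close> is deleted and the search continues from \<open>y\<close> along
  another edge. The leaf found in the smaller forest is neither \<open>x\<close> nor
  \<open>y\<close>, as a way back would bypass a bridge.\<close>

lemma forest_branch_leaf:
  assumes "finite S" "\<forall>f\<in>S. card f = 2" "forest S" "{x, y} \<in> S"
  obtains z where "linked (S - {{x, y}}) y z" "card (nbrs S z) = 1"
proof -
  have "\<exists>z. linked (S - {{x, y}}) y z \<and> card (nbrs S z) = 1"
    using assms
  proof (induction "card S" arbitrary: S x y rule: less_induct)
    case less
    have "x \<noteq> y" using less.prems by fastforce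
    show ?case
    proof (cases "nbrs S y = {x}")
      case True
      then show ?thesis by (intro exI[of _ y]) auto
    next
      case False
      then obtain y' where y': "{y, y'} \<in> S" "y' \<noteq> x"
        using less.prems(4) by (auto simp: nbrs_def insert_commute)
      let ?T = "S - {{x, y}}"
      have T: "card ?T < card S" "finite ?T" "\<forall>f\<in>?T. card f = 2" "forest ?T" "{y, y'} \<in> ?T"
        using less.prems y' \<open>x \<noteq> y\<close>
        by (auto simp: doubleton_eq_iff card_Diff1_less intro: forest_subset simp del: card_Diff_insert)
      obtain z where z: "linked (?T - {{y, y'}}) y' z" "card (nbrs ?T z) = 1"
        using less.hyps[OF T] by blast
      have "card {y, y'} = 2" using T by blast
      then have "y \<noteq> y'" by auto
      have "z \<noteq> y" using z(1) forestD[OF T(4,5) \<open>y \<noteq> y'\<close>] linked_sym by metis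
      have "linked ?T y' z" using z(1) by (rule linked_mono) auto
      then have yz: "linked ?T y z" using linked_edge[OF T(5)] linked_trans by metis
      then have "z \<noteq> x" using forestD[OF less.prems(3,4) \<open>x \<noteq> y\<close>] linked_sym by metis
      \<comment> \<open>Deleting \<open>{x, y}\<close> changes degrees only at \<open>x\<close> and
        \<open>y\<close>, so \<open>z\<close> is a leaf of \<open>S\<close> too.\<close>
      have "nbrs ?T z = nbrs S z"
        using \<open>z \<noteq> x\<close> \<open>z \<noteq> y\<close> by (auto simp: nbrs_def doubleton_eq_iff)
      then show ?thesis using z yz by auto
    qed
  qed
  with that show ?thesis by blast
qed

section \<open>Cycles and bridges\<close>

lemma cycle_edges_rotate: "cycle_edges (xs @ ys) = cycle_edges (ys @ xs)"
proof (cases "xs = [] \<or> ys = []")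
  case False
  then obtain x xs' y ys' where *: "xs = x # xs'" "ys = y # ys'" by (meson list.exhaust)
  have "path_edges ((x # xs') @ y # ys' @ [x]) = path_edges ((x # xs') @ [y]) \<union> path_edges (y # ys' @ [x])"
    by (rule path_edges_append)
  moreover have "path_edges ((y # ys') @ x # xs' @ [y]) = path_edges ((y # ys') @ [x]) \<union> path_edges (x # xs' @ [y])"
    by (rule path_edges_append)
  ultimately show ?thesis by (auto simp: cycle_edges_def *)
qed auto

lemma cycle_edges_closing:
  assumes "c \<noteq> []" shows "cycle_edges c = insert {last c, hd c} (path_edges c)"
proof -
  have "c @ [hd c] = butlast c @ last c # [hd c]" using assms by simp
  then have "cycle_edges c = path_edges (butlast c @ [last c]) \<union> path_edges [last c, hd c]"
    unfolding cycle_edges_def by (metis path_edges_append)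
  then show ?thesis using assms by auto
qed

text \<open>Rotation makes the given edge the closing one, and the remaining edges contain a path
  between its ends. Length at least three keeps the closing edge from occurring on that path as
  well.\<close>

lemma cycle_edge_not_bridge:
  assumes "is_cycle V E c" "{a, b} \<in> cycle_edges c"
  shows "linked (cycle_edges c - {{a, b}}) a b"
proof -
  have closing: "linked (cycle_edges d - {{last d, hd d}}) (hd d) (last d)"
    if d: "distinct d" "3 \<le> length d" for d :: "'a list"
  proof -
    obtain x y ys where xy: "d = x # y # ys" "ys \<noteq> []" using d
      by (metis Suc_le_length_iff length_0_conv not_less_eq_eq numeral_3_eq_3 zero_le list.distinct(1))
    have "{last d, hd d} \<notin> path_edges d"
    proof
      assume "{last d, hd d} \<in> path_edges d"
      then have "{last ys, x} \<in> path_edges (y # ys) \<or> {last ys, x} = {x, y}" using xy by auto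
      then show False
      proof
        assume "{last ys, x} \<in> path_edges (y # ys)"
        then have "x \<in> set (y # ys)" using path_edges_subset by blast
        then show False using d xy by auto
      next
        assume "{last ys, x} = {x, y}"
        then show False using d xy last_in_set[of ys] by (auto simp: doubleton_eq_iff)
      qed
    qed
    moreover have "linked (path_edges d) (hd d) (last d)" using xy by (intro linked_path_edges) auto
    ultimately show ?thesis using xy(1) by (auto simp: cycle_edges_closing elim!: linked_mono)
  qed
  have c: "distinct c" "3 \<le> length c" using assms(1) by (auto simp: is_cycle_def)
  then have "c \<noteq> []" by auto
  obtain d where d: "distinct d" "3 \<le> length d" "cycle_edges d = cycle_edges c" "{a, b} = {last d, hd d}"
  proof (cases "{a, b} = {last c, hd c}")
    case True
    then show ?thesis using c that by blast
  next
    case False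
    then obtain i where i: "Suc i < length c" "{a, b} = {c ! i, c ! Suc i}"
      using assms(2) \<open>c \<noteq> []\<close> by (auto simp: cycle_edges_closing path_edges_nth)
    \<comment> \<open>The list is cut between positions \<open>i\<close> and \<open>Suc i\<close>,
      so that these two vertices become its last and first.\<close>
    let ?d = "drop (Suc i) c @ take (Suc i) c"
    have "cycle_edges ?d = cycle_edges c" by (subst cycle_edges_rotate) simp
    moreover have "distinct ?d" using c by (metis append_take_drop_id distinct_append inf_commute)
    moreover have "hd ?d = c ! Suc i" using i by (simp add: hd_drop_conv_nth)
    moreover have "last ?d = c ! i" using i \<open>c \<noteq> []\<close> by (simp add: take_Suc_conv_app_nth)
    ultimately show ?thesis using that[of ?d] c i by auto
  qed
  have "linked (cycle_edges c - {{a, b}}) (hd d) (last d)" using closing[OF d(1,2)] d(3,4) by simp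
  then show ?thesis using d(4) linked_sym by (metis doubleton_eq_iff)
qed

text \<open>A path in \<open>S\<close> is closed by the edge \<open>{a, b}\<close>. Since
  \<open>S\<close> lacks that edge, the path has a third vertex, as a cycle list requires.\<close>

lemma linked_cycle:
  assumes "\<forall>f\<in>E. f \<subseteq> V" "S \<subseteq> E" "{a, b} \<in> E" "a \<noteq> b" "{a, b} \<notin> S" "linked S a b"
  obtains c where "is_cycle V E c" "cycle_edges c \<subseteq> insert {a, b} S" "{a, b} \<in> cycle_edges c"
proof -
  obtain p where p: "p \<noteq> []" "hd p = a" "last p = b" "distinct p" "path_edges p \<subseteq> S"
    using linked_path[OF assms(6)] .
  obtain y ys where ys: "p = a # y # ys"
    using p(1-3) assms(4) by (metis last_ConsL list.exhaust_sel)
  have "ys \<noteq> []" using p ys assms(5) by auto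
  then have "3 \<le> length p" using ys by (cases ys) auto
  have ce: "cycle_edges p = insert {a, b} (path_edges p)"
    using p by (simp add: cycle_edges_closing insert_commute)
  have "set p \<subseteq> \<Union>(path_edges p)" using ys by (intro set_subset_Union_path_edges) auto
  then have "set p \<subseteq> V" using p assms(1,2) by blast
  then have "is_cycle V E p" using p \<open>3 \<le> length p\<close> ce assms by (auto simp: is_cycle_def)
  then show ?thesis using that ce p by auto
qed

subsection \<open>Highly connected graphs\<close>

lemma k_connected_linked:
  assumes "k_connected k V E" "X \<subseteq> V" "card X < k" "a \<in> V - X" "b \<in> V - X"
  shows "linked {f \<in> E. f \<inter> X = {}} a b"
proof -
  obtain p where "is_path (V - X) {f \<in> E. f \<inter> X = {}} a p b"
    using assms unfolding k_connected_def connected_graph_def by blast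
  then show ?thesis
    using linked_path_edges[of p] by (auto simp: is_path_def elim: linked_mono)
qed

lemma finite_nbrs: "simple_graph V E \<Longrightarrow> S \<subseteq> E \<Longrightarrow> finite (nbrs S x)"
  by (rule finite_subset[of _ V]) (fastforce simp: simple_graph_def nbrs_def)+

text \<open>With fewer than \<open>k\<close> neighbours, deleting them all isolates
  \<open>x\<close>, while another vertex survives because \<open>V\<close> has more than
  \<open>k\<close> elements.\<close>

lemma k_connected_min_degree:
  assumes "simple_graph V E" "k_connected k V E" "x \<in> V"
  shows "k \<le> card (nbrs E x)"
proof (rule ccontr)
  assume deg: "\<not> k \<le> card (nbrs E x)"
  let ?N = "nbrs E x"
  have fin: "finite V" and N: "?N \<subseteq> V" using assms(1) by (auto simp: simple_graph_def nbrs_def)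
  have "x \<notin> ?N" using assms(1) by (auto simp: simple_graph_def nbrs_def)
  have "card (insert x ?N) \<le> k" using deg finite_subset[OF N fin] by (simp add: card_insert_if)
  also have "k < card V" using assms(2) by (simp add: k_connected_def)
  finally have "insert x ?N \<noteq> V" by blast
  then obtain y where y: "y \<in> V" "y \<noteq> x" "y \<notin> ?N" using N assms(3) by blast
  have "linked {f \<in> E. f \<inter> ?N = {}} x y"
    using k_connected_linked[OF assms(2) N] deg y assms(3) \<open>x \<notin> ?N\<close> by auto
  then obtain c d where "{c, d} \<in> {f \<in> E. f \<inter> ?N = {}}" "c \<in> {x}" "d \<notin> {x}"
    by (rule linked_crossing_edge[of _ _ _ "{x}"]) (use y in auto)
  then show False by (auto simp: nbrs_def)
qed

text \<open>This is the 2-connectedness of the graph without the edge \<open>{a, b}\<close>.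
  Deleting both \<open>x\<close> and \<open>b\<close> destroys that edge too, so 3-connectedness
  settles every \<open>y\<close> other than \<open>b\<close>; and \<open>b\<close> has a neighbour
  besides \<open>a\<close> and \<open>x\<close> to start from.\<close>

lemma three_connected_delete_edge_linked:
  assumes G: "simple_graph V E" "k_connected 3 V E" and e: "{a, b} \<in> E"
    and x: "x \<in> V" "x \<noteq> a" and y: "y \<in> V" "y \<noteq> x"
  shows "linked {f \<in> E - {{a, b}}. x \<notin> f} y a"
proof -
  let ?S = "{f \<in> E - {{a, b}}. x \<notin> f}"
  have ab: "a \<in> V" "b \<in> V" "a \<noteq> b" using G(1) e by (auto simp: simple_graph_def)
  have card: "card {x, b} < 3" by (simp add: card_insert_if)
  have avoid: "linked {f \<in> E. f \<inter> {x, b} = {}} z a" if "z \<in> V" "z \<noteq> x" "z \<noteq> b" for z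
    by (rule k_connected_linked[OF G(2) _ card]) (use that ab x in auto)
  have base: "linked ?S z a" if "z \<in> V" "z \<noteq> x" "z \<noteq> b" for z
    by (rule linked_mono[OF avoid[OF that]]) auto
  show ?thesis
  proof (cases "y = b")
    case True
    have "\<not> nbrs E b \<subseteq> {a, x}"
    proof
      assume "nbrs E b \<subseteq> {a, x}"
      then have "card (nbrs E b) \<le> card {a, x}" by (intro card_mono) auto
      also have "\<dots> \<le> 2" by (simp add: card_insert_if)
      finally show False using k_connected_min_degree[OF G ab(2)] by simp
    qed
    then obtain t where t: "{b, t} \<in> E" "t \<noteq> a" "t \<noteq> x" by (auto simp: nbrs_def)
    then have "t \<in> V" "t \<noteq> b" using G(1) by (auto simp: simple_graph_def)
    then have "linked ?S t a" using base t by blast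
    moreover have "linked ?S b t" using t y True ab by (intro linked_edge) (auto simp: doubleton_eq_iff)
    ultimately have "linked ?S b a" by (rule linked_trans[rotated])
    then show ?thesis using True by simp
  qed (use base y in blast)
qed

text \<open>Whitney's argument: a pair of internally disjoint paths is pushed along one edge at a time.
  A degenerate pair consisting of twice the same edge is allowed, which provides the first step.\<close>

lemma two_internally_disjoint_paths:
  assumes conn: "\<And>x y. x \<noteq> a \<Longrightarrow> {x, y} \<in> S \<Longrightarrow> linked {f \<in> S. x \<notin> f} y a"
    and card2: "\<forall>f\<in>S. card f = 2" and "linked S a b" "a \<noteq> b"
  obtains p q where "p \<noteq> []" "hd p = a" "last p = b" "distinct p" "path_edges p \<subseteq> S"
    "q \<noteq> []" "hd q = a" "last q = b" "distinct q" "path_edges q \<subseteq> S" "set p \<inter> set q = {a, b}"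
proof -
  define path where "path p z \<longleftrightarrow> p \<noteq> [] \<and> hd p = a \<and> last p = z \<and> distinct p \<and> path_edges p \<subseteq> S"
    for p z
  define two where "two z \<longleftrightarrow> (\<exists>p q. path p z \<and> path q z \<and> set p \<inter> set q = {a, z})" for z
  \<comment> \<open>The path \<open>r\<close> leads from the next vertex \<open>y\<close> to its
    first hit \<open>?t\<close> on the two paths, here on \<open>p\<close>. The new pair follows
    \<open>p\<close> up to \<open>?t\<close> and then \<open>r\<close> backwards, and prolongs
    \<open>q\<close> by the edge \<open>{x, y}\<close>.\<close>
  have extend: "two y"
    if pq: "path p x" "path q x" "set p \<inter> set q = {a, x}" and xy: "{x, y} \<in> S" "y \<noteq> a"
      and r: "r \<noteq> []" "hd r = y" "last r \<in> set p" "set (butlast r) \<inter> (set p \<union> set q) = {}"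
        "distinct r" "path_edges r \<subseteq> S" "x \<notin> set r"
    for p q x y r
  proof -
    let ?t = "last r"
    have r_split: "set r = insert ?t (set (butlast r))"
      using r(1) by (metis append_butlast_last_id list.simps(15) rotate1.simps(2) set_rotate1)
    obtain p1 p2 where p: "p = p1 @ ?t # p2" using r(3) by (metis split_list)
    have "?t \<noteq> x" using r(1,7) last_in_set by metis
    then have "p2 \<noteq> []" using pq(1) p by (auto simp: path_def)
    then have "x \<in> set p2" using pq(1) p by (metis last_append last_ConsR last_in_set list.distinct(1) path_def)
    then have "x \<notin> set p1" using pq(1) p by (auto simp: path_def)
    have "?t \<notin> set p1" using pq(1) p by (auto simp: path_def)
    \<comment> \<open>The hit may be the common start \<open>a\<close>; this is the only way it can
      lie on both paths, since \<open>r\<close> avoids \<open>x\<close>.\<close>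
    have tq: "?t \<in> set q \<Longrightarrow> ?t = a" using pq(3) r(3) \<open>?t \<noteq> x\<close> by auto
    have yr: "y \<in> set r" using r(1,2) by auto
    have "y \<notin> set q" using yr r_split r(4) tq xy(2) by auto
    obtain ts where ts: "rev r = ?t # ts" using r(1) by (metis append_butlast_last_id rev.simps(2) rev_rev_ident rev_append append_Cons append_Nil)
    have "path_edges (p1 @ rev r) = path_edges (p1 @ [?t]) \<union> path_edges (rev r)"
      unfolding ts by (rule path_edges_append)
    moreover have "path_edges p = path_edges (p1 @ [?t]) \<union> path_edges (?t # p2)"
      by (subst p) (rule path_edges_append)
    ultimately have "path_edges (p1 @ rev r) \<subseteq> S"
      using pq(1) r(6) by (auto simp: path_def path_edges_rev)
    moreover have "hd (p1 @ rev r) = a"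
      using pq(1) p ts by (cases p1) (auto simp: path_def)
    moreover have "last (p1 @ rev r) = y" using r(1,2) by (simp add: last_rev)
    moreover have "set p1 \<inter> set r = {}" using r_split r(4) \<open>?t \<notin> set p1\<close> p by auto
    ultimately have 1: "path (p1 @ rev r) y" using pq(1) p r by (auto simp: path_def)
    have "path_edges (q @ [y]) = path_edges q \<union> {{x, y}}"
    proof -
      have "q @ [y] = butlast q @ x # [y]" using pq(2) by (auto simp: path_def)
      then have "path_edges (q @ [y]) = path_edges (butlast q @ [x]) \<union> path_edges [x, y]"
        by (metis path_edges_append)
      then show ?thesis using pq(2) by (auto simp: path_def)
    qed
    then have 2: "path (q @ [y]) y" using pq(2) xy \<open>y \<notin> set q\<close> by (auto simp: path_def)
    have "set p1 \<inter> set q \<subseteq> {a}" using pq(3) p \<open>x \<notin> set p1\<close> by auto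
    moreover have "set r \<inter> set q \<subseteq> {a}" using r_split r(4) tq by auto
    moreover have "a \<in> set (p1 @ rev r)" "a \<in> set q"
      using 1 pq(2) by (metis path_def hd_in_set)+
    ultimately have "set (p1 @ rev r) \<inter> set (q @ [y]) = {a, y}" using yr by auto
    then show ?thesis using 1 2 two_def by blast
  qed
  \<comment> \<open>Induction along a walk from \<open>a\<close>. The first alternative is needed
    because the walk may return to \<open>a\<close>.\<close>
  have "b = a \<or> two b"
    using \<open>linked S a b\<close> unfolding linked_def
  proof (induction rule: rtranclp_induct)
    case (step x y)
    have "card {x, y} = 2" using card2 step.hyps by blast
    then have "x \<noteq> y" by auto
    show ?case
    proof (cases "y = a \<or> x = a")
      case True
      have "two y" if "y \<noteq> a" "x = a"
        unfolding two_def path_def using that step.hyps by (intro exI[of _ "[a, y]"]) auto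
      then show ?thesis using True by blast
    next
      case False
      then obtain p q where pq: "path p x" "path q x" "set p \<inter> set q = {a, x}"
        using step.IH by (auto simp: two_def)
      have "linked {f \<in> S. x \<notin> f} y a" using conn False step.hyps by blast
      moreover have "a \<in> set p \<union> set q" using pq(3) by auto
      ultimately obtain r where r: "r \<noteq> []" "hd r = y" "last r \<in> set p \<union> set q"
        "set (butlast r) \<inter> (set p \<union> set q) = {}" "distinct r" "path_edges r \<subseteq> {f \<in> S. x \<notin> f}"
        by (rule linked_first_hit)
      \<comment> \<open>The edges of \<open>r\<close> avoid \<open>x\<close>, which says nothing
        about a single-vertex \<open>r\<close>; that one is \<open>[y]\<close>.\<close>
      have "x \<notin> set r"
      proof (cases "2 \<le> length r")
        case True
        then show ?thesis using set_subset_Union_path_edges[of r] r(6) by blast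
      next
        case False
        then have "r = [y]" using r(1,2) by (cases r; cases "tl r") auto
        then show ?thesis using \<open>x \<noteq> y\<close> by simp
      qed
      moreover have "path_edges r \<subseteq> S" using r(6) by blast
      moreover have "set q \<inter> set p = {a, x}" using pq(3) by blast
      moreover have "set (butlast r) \<inter> (set q \<union> set p) = {}" using r(4) by blast
      ultimately have "two y"
        using extend[OF pq step.hyps(2) _ r(1,2) _ r(4,5)]
          extend[OF pq(2,1) _ step.hyps(2) _ r(1,2) _ _ r(5)] r(3) False by blast
      then show ?thesis by simp
    qed
  qed simp
  then show ?thesis using \<open>a \<noteq> b\<close> that by (auto simp: two_def path_def)
qed

section \<open>Forests beside a path, and the edges off two paths\<close>

definition no_disjoint_cycles_through :: "'a set \<Rightarrow> 'a set set \<Rightarrow> 'a set \<Rightarrow> bool" where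
  "no_disjoint_cycles_through V E e \<longleftrightarrow>
     \<not> (\<exists>C D. is_cycle V E C \<and> is_cycle V E D \<and>
         cycle_edges C \<inter> cycle_edges D = {} \<and> e \<in> cycle_edges C \<union> cycle_edges D)"

text \<open>\<open>S\<close> contains a path that \<open>{a, b}\<close> closes to a cycle, and an
  edge of \<open>T\<close> that is no bridge lies on a cycle edge-disjoint from it. The absence of
  cycle pairs enters the construction of the ladder only in this form.\<close>

lemma no_disjoint_cycles_forest:
  assumes "simple_graph V E" "{a, b} \<in> E" "no_disjoint_cycles_through V E {a, b}"
    and S: "S \<subseteq> E - {{a, b}}" "linked S a b" and T: "T \<subseteq> E - {{a, b}}" and "S \<inter> T = {}"
  shows "forest T"
  unfolding forest_def
proof (intro allI impI notI)
  fix c d assume cd: "c \<noteq> d" "{c, d} \<in> T" "linked (T - {{c, d}}) c d"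
  have E: "\<forall>f\<in>E. f \<subseteq> V" and "a \<noteq> b" using assms(1,2) by (auto simp: simple_graph_def)
  obtain C where C: "is_cycle V E C" "cycle_edges C \<subseteq> insert {a, b} S" "{a, b} \<in> cycle_edges C"
    by (rule linked_cycle[OF E _ assms(2) \<open>a \<noteq> b\<close> _ S(2)]) (use S(1) in auto)
  obtain D where D: "is_cycle V E D" "cycle_edges D \<subseteq> insert {c, d} (T - {{c, d}})"
    by (rule linked_cycle[OF E _ _ cd(1) _ cd(3)]) (use T cd(2) in auto)
  have "cycle_edges C \<inter> cycle_edges D = {}" using C(2) D(2) cd(2) T \<open>S \<inter> T = {}\<close> by blast
  then show False using assms(3) C D unfolding no_disjoint_cycles_through_def by blast
qed

lemma linked_path_edges_mem:
  assumes "x \<in> set p" "y \<in> set p" shows "linked (path_edges p) x y"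
proof -
  have "linked (path_edges p) (hd p) z" if "z \<in> set p" for z
  proof -
    obtain xs ys where p: "p = xs @ z # ys" using \<open>z \<in> set p\<close> by (metis split_list)
    have "linked (path_edges (xs @ [z])) (hd (xs @ [z])) z"
      using linked_path_edges[of "xs @ [z]"] by simp
    moreover have "path_edges (xs @ [z]) \<subseteq> path_edges p"
      unfolding p by (subst path_edges_append) blast
    moreover have "hd (xs @ [z]) = hd p" unfolding p by (cases xs) auto
    ultimately show ?thesis using linked_mono by metis
  qed
  then show ?thesis using assms linked_sym linked_trans by metis
qed

text \<open>A component of the graph off the two paths is a tree that meets each path at most once,
  while all its leaves lie on the paths.\<close>

lemma off_path_edges_matching:
  assumes G: "simple_graph V E" and deg: "\<And>x. x \<in> V \<Longrightarrow> 3 \<le> card (nbrs E x)"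
    and H: "H = E - {{u, u'}}" and "{u, u'} \<in> E"
    and p: "distinct p" "path_edges p \<subseteq> H" "forest (H - path_edges p)"
    and q: "distinct q" "path_edges q \<subseteq> H" "forest (H - path_edges q)"
    and pq: "set p \<inter> set q = {u, u'}"
    and F: "F = H - path_edges p - path_edges q"
  shows "V \<subseteq> set p \<union> set q"
    and "x \<in> {u, u'} \<Longrightarrow> nbrs F x = {}"
    and "x \<in> V \<Longrightarrow> x \<in> set p - {u, u'} \<Longrightarrow> \<exists>y \<in> set q - {u, u'}. nbrs F x = {y}"
proof -
  have G': "finite V" "\<forall>f\<in>E. f \<subseteq> V \<and> card f = 2" using G by (auto simp: simple_graph_def)
  have "finite E" using G' by (intro finite_subset[of E "Pow V"]) auto
  then have "finite F" using F H by auto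
  have FE: "F \<subseteq> E" using F H by auto
  have F2: "\<forall>f\<in>F. card f = 2" using FE G' by auto
  have FV: "y \<in> V \<and> z \<in> V" if "{y, z} \<in> F" for y z
  proof -
    have "{y, z} \<subseteq> V" using that FE G'(2) by blast
    then show ?thesis by simp
  qed
  have fin: "finite (nbrs S z)" if "S \<subseteq> E" for S z
    using finite_nbrs[OF G that] .
  \<comment> \<open>A common edge would have both ends among \<open>u\<close> and \<open>u'\<close>,
    so it would be the deleted edge.\<close>
  have disj: "path_edges p \<inter> path_edges q = {}"
  proof (rule ccontr)
    assume "path_edges p \<inter> path_edges q \<noteq> {}"
    then obtain f where f: "f \<in> path_edges p" "f \<in> path_edges q" by auto
    then have "f \<subseteq> {u, u'}" using pq path_edges_subset by fast
    moreover have "card f = 2" "card {u, u'} = 2" using f p(2) H G' \<open>{u, u'} \<in> E\<close> by auto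
    ultimately have "f = {u, u'}" by (intro card_subset_eq) auto
    then show False using f p(2) H by auto
  qed
  have pU: "F \<union> path_edges q = H - path_edges p" "F \<inter> path_edges q = {}"
    using F q(2) disj by auto
  have qU: "F \<union> path_edges p = H - path_edges q" "F \<inter> path_edges p = {}"
    using F p(2) disj by auto
  have forest: "forest F" using forest_subset[OF p(3)] F by auto
  have uniq_q: "y = z" if "y \<in> set q" "z \<in> set q" "linked F y z" for y z
    using forest_linked_unique[of F "path_edges q"] p(3) pU that linked_path_edges_mem by metis
  have uniq_p: "y = z" if "y \<in> set p" "z \<in> set p" "linked F y z" for y z
    using forest_linked_unique[of F "path_edges p"] q(3) qU that linked_path_edges_mem by metis
  have off: "nbrs F z = nbrs E z" if "z \<notin> set p \<union> set q" for z
    using that pq F H path_edges_subset by (fastforce simp: nbrs_def doubleton_eq_iff)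
  \<comment> \<open>A leaf off both paths would keep all its edges in \<open>F\<close> and so have
    degree one in the whole graph, against the minimum degree.\<close>
  have leaf: "\<exists>z. linked (F - {{x, y}}) y z \<and> z \<in> set p \<union> set q \<and> z \<noteq> x \<and> linked F x z"
    if "{x, y} \<in> F" for x y
  proof -
    obtain z where z: "linked (F - {{x, y}}) y z" "card (nbrs F z) = 1"
      using forest_branch_leaf[OF \<open>finite F\<close> F2 forest \<open>{x, y} \<in> F\<close>] .
    have "card {x, y} = 2" using F2 that by blast
    then have "x \<noteq> y" by auto
    have "nbrs F z \<noteq> {}" using z(2) by auto
    then have "z \<in> V" using FV by (auto simp: nbrs_def)
    then have "z \<in> set p \<union> set q" using off[of z] deg[of z] z(2) by force
    moreover have "z \<noteq> x" using z(1) forestD[OF forest that \<open>x \<noteq> y\<close>] linked_sym by metis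
    moreover have "linked F x z"
      using linked_edge[OF that] linked_mono[OF z(1)] linked_trans by (metis Diff_subset)
    ultimately show ?thesis using z(1) by blast
  qed
  \<comment> \<open>One leaf is chosen behind each edge of \<open>F\<close> at \<open>x\<close>.
    Branches are disjoint, so the component of \<open>x\<close> has as many such leaves as
    \<open>x\<close> has edges in \<open>F\<close>.\<close>
  have leaves: "\<exists>Z \<subseteq> set p \<union> set q. finite Z \<and> card Z = card (nbrs F x) \<and> (\<forall>z\<in>Z. z \<noteq> x \<and> linked F x z)" for x
  proof -
    have "\<forall>y\<in>nbrs F x. \<exists>z. linked (F - {{x, y}}) y z \<and> z \<in> set p \<union> set q \<and> z \<noteq> x \<and> linked F x z"
      using leaf by (simp add: nbrs_def)
    then obtain g where g: "\<forall>y\<in>nbrs F x. linked (F - {{x, y}}) y (g y) \<and> g y \<in> set p \<union> set q \<and>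
      g y \<noteq> x \<and> linked F x (g y)" by metis
    have "inj_on g (nbrs F x)"
    proof (rule inj_onI, rule ccontr)
      fix y y' assume *: "y \<in> nbrs F x" "y' \<in> nbrs F x" "g y = g y'" "y \<noteq> y'"
      then have e: "{x, y} \<in> F" "{x, y'} \<in> F" by (auto simp: nbrs_def)
      then have "card {x, y} = 2" "card {x, y'} = 2" using F2 by blast+
      then have "x \<noteq> y" "x \<noteq> y'" by auto
      then show False using forest_branches_disjoint[OF forest e _ _ *(4)] g * by metis
    qed
    then show ?thesis using g fin[OF FE, of x] by (intro exI[of _ "g ` nbrs F x"]) (auto simp: card_image)
  qed
  have le1: "card Z \<le> 1" if "\<forall>z\<in>Z. linked F x z" "Z \<subseteq> set p \<or> Z \<subseteq> set q" for Z x
  proof -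
    have "y = z" if yz: "y \<in> Z" "z \<in> Z" for y z
    proof -
      have "linked F y z" using \<open>\<forall>z\<in>Z. linked F x z\<close> yz linked_sym linked_trans by metis
      then show ?thesis using uniq_p uniq_q yz \<open>Z \<subseteq> set p \<or> Z \<subseteq> set q\<close> by blast
    qed
    moreover have "finite Z" using that(2) finite_subset by blast
    ultimately show ?thesis by (auto simp: card_le_Suc0_iff_eq)
  qed
  \<comment> \<open>A vertex off the paths has at least three branches, but each of the two paths
    can take only one leaf.\<close>
  show V: "V \<subseteq> set p \<union> set q"
  proof (rule ccontr)
    assume "\<not> V \<subseteq> set p \<union> set q"
    then obtain x where x: "x \<in> V" "x \<notin> set p \<union> set q" by blast
    obtain Z where Z: "Z \<subseteq> set p \<union> set q" "finite Z" "card Z = card (nbrs F x)" "\<forall>z\<in>Z. z \<noteq> x \<and> linked F x z"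
      using leaves by blast
    have "card (Z \<inter> set p) \<le> 1" "card (Z \<inter> set q) \<le> 1" by (rule le1[of _ x]; use Z(4) in auto)+
    moreover have "card Z \<le> card (Z \<inter> set p) + card (Z \<inter> set q)"
      using card_Un_le[of "Z \<inter> set p" "Z \<inter> set q"] Z(1) by (simp add: Int_Un_distrib[symmetric] Int_absorb2)
    ultimately show False using deg[OF x(1)] off[OF x(2)] Z(3) by simp
  qed
  \<comment> \<open>An end lies on both paths, so its component has no further vertex on
    either.\<close>
  show "nbrs F x = {}" if "x \<in> {u, u'}"
  proof -
    obtain Z where Z: "Z \<subseteq> set p \<union> set q" "finite Z" "card Z = card (nbrs F x)" "\<forall>z\<in>Z. z \<noteq> x \<and> linked F x z"
      using leaves by blast
    have "x \<in> set p" "x \<in> set q" using that pq by auto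
    then have "Z = {}" using Z(1,4) uniq_p uniq_q by blast
    then show ?thesis using Z(3) fin[OF FE, of x] by auto
  qed
  \<comment> \<open>All leaves lie on \<open>q\<close>, which leaves at most one edge of
    \<open>F\<close> at \<open>x\<close>. At most two edges at \<open>x\<close> belong to
    \<open>p\<close> and none to \<open>q\<close>, so degree three forces exactly one.\<close>
  show "\<exists>y \<in> set q - {u, u'}. nbrs F x = {y}" if x: "x \<in> V" "x \<in> set p - {u, u'}"
  proof -
    obtain Z where Z: "Z \<subseteq> set p \<union> set q" "finite Z" "card Z = card (nbrs F x)" "\<forall>z\<in>Z. z \<noteq> x \<and> linked F x z"
      using leaves by blast
    have "Z \<subseteq> set q" using Z(1,4) uniq_p x by blast
    then have le: "card (nbrs F x) \<le> 1" using le1[of Z x] Z(3,4) by auto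
    have "x \<notin> set q" using x pq by auto
    then have "nbrs E x \<subseteq> nbrs F x \<union> nbrs (path_edges p) x"
      using x F H path_edges_subset by (fastforce simp: nbrs_def doubleton_eq_iff)
    then have "card (nbrs E x) \<le> card (nbrs F x \<union> nbrs (path_edges p) x)"
      using fin[OF FE] fin[of "path_edges p"] p(2) H by (intro card_mono) auto
    also have "\<dots> \<le> card (nbrs F x) + card (nbrs (path_edges p) x)" by (rule card_Un_le)
    finally have "card (nbrs F x) = 1" using deg[OF x(1)] card_nbrs_path_edges[OF p(1), of x] le by linarith
    then obtain y where y: "nbrs F x = {y}" by (auto simp: card_1_singleton_iff)
    then have xy: "{x, y} \<in> F" by (auto simp: nbrs_def)
    then have "card {x, y} = 2" "y \<in> V" using F2 FV by auto
    then have "y \<noteq> x" by auto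
    then have "y \<notin> set p" using uniq_p[of x y] linked_edge[OF xy] x by blast
    then show ?thesis using y V \<open>y \<in> V\<close> pq by auto
  qed
qed

section \<open>Index constraints on the rungs\<close>

lemma linked_chain:
  assumes "\<And>i. lo \<le> i \<Longrightarrow> i < hi \<Longrightarrow> {v i, v (Suc i)} \<in> U" "a \<in> {lo..hi}" "b \<in> {lo..hi}"
  shows "linked U (v a) (v b)"
proof -
  have "linked U (v lo) (v c)" if "lo \<le> c" "c \<le> hi" for c
    using that
  proof (induction c rule: dec_induct)
    case (step c)
    then show ?case using linked_edge[OF assms(1), of c] linked_trans by (metis Suc_leD Suc_le_lessD)
  qed simp
  then show ?thesis using assms(2,3) linked_sym linked_trans by (metis atLeastAtMost_iff)
qed

text \<open>If the rung at \<open>v i\<close> ended beyond \<open>w (Suc i)\<close>, then by counting two other rungs would join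
  the part of \<open>v\<close> after \<open>i\<close> to the part of \<open>w\<close> before \<open>\<pi> i\<close>. They close a cycle there, which
  avoids the path that switches sides along the rung at \<open>v i\<close>.\<close>

lemma rung_not_long:
  fixes v w :: "nat \<Rightarrow> 'a" and \<pi> :: "nat \<Rightarrow> nat"
  assumes ends: "v 0 = w 0" "v (Suc n) = w (Suc m)"
    and v: "inj_on v {..Suc n}" and w: "inj_on w {..Suc m}"
    and vw: "\<And>i j. i \<in> {1..n} \<Longrightarrow> j \<le> Suc m \<Longrightarrow> v i \<noteq> w j"
      "\<And>i j. i \<le> Suc n \<Longrightarrow> j \<in> {1..m} \<Longrightarrow> v i \<noteq> w j"
    and vE: "\<And>i. i \<le> n \<Longrightarrow> {v i, v (Suc i)} \<in> H"
    and wE: "\<And>j. j \<le> m \<Longrightarrow> {w j, w (Suc j)} \<in> H"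
    and \<pi>: "bij_betw \<pi> {1..n} {1..m}" "\<And>i. i \<in> {1..n} \<Longrightarrow> {v i, w (\<pi> i)} \<in> H"
    and H: "{} \<notin> H"
    and sep: "\<And>S T. S \<subseteq> H \<Longrightarrow> T \<subseteq> H \<Longrightarrow> S \<inter> T = {} \<Longrightarrow> linked S (v 0) (v (Suc n)) \<Longrightarrow> forest T"
    and i: "i \<in> {1..n}"
  shows "\<pi> i \<le> Suc i"
proof (rule ccontr)
  assume long: "\<not> \<pi> i \<le> Suc i"
  define k where "k = \<pi> i"
  have im: "\<pi> ` {1..n} = {1..m}" and inj: "inj_on \<pi> {1..n}" using \<pi>(1) by (auto simp: bij_betw_def)
  have k: "k \<in> {1..m}" "Suc (Suc i) \<le> k" using im i long by (auto simp: k_def)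
  \<comment> \<open>Exactly \<open>k - 1\<close> rungs end before \<open>k\<close> on
    \<open>w\<close>, and at most \<open>i - 1\<close> of them start before \<open>i\<close> on
    \<open>v\<close>. As \<open>k\<close> is at least \<open>i + 2\<close>, two or more start after
    \<open>i\<close>; these form \<open>?A\<close>.\<close>
  let ?L = "{l \<in> {1..n}. \<pi> l < k}" let ?A = "{l \<in> {Suc i..n}. \<pi> l < k}"
  have "\<pi> ` ?L = \<pi> ` {1..n} \<inter> {..<k}" by auto
  also have "\<dots> = {1..<k}" using k unfolding im by auto
  finally have "card (\<pi> ` ?L) = k - 1" by simp
  moreover have "card (\<pi> ` ?L) = card ?L" by (rule card_image) (rule inj_on_subset[OF inj], auto)
  moreover have "card ?L \<le> card ({1..<i} \<union> ?A)"
  proof (intro card_mono)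
    show "?L \<subseteq> {1..<i} \<union> ?A"
    proof
      fix l assume "l \<in> ?L"
      then show "l \<in> {1..<i} \<union> ?A" by (cases "l = i") (auto simp: k_def)
    qed
  qed auto
  moreover have "card ({1..<i} \<union> ?A) \<le> card {1..<i} + card ?A" by (rule card_Un_le)
  ultimately have "2 \<le> card ?A" using k i by simp
  then obtain j l where jl: "j \<in> ?A" "l \<in> ?A" "j \<noteq> l"
    by (metis (no_types, lifting) card.empty card_1_singleton_iff card_le_Suc0_iff_eq card_ge_0_finite
      not_less_eq_eq numeral_2_eq_2 zero_less_Suc order_less_le_trans)
  \<comment> \<open>\<open>X\<close> carries the path that changes sides along the rung at
    \<open>v i\<close>. \<open>Y\<close> is the rest; it contains neither common end.\<close>
  define X where "X = v ` {..i} \<union> w ` {k..Suc m}"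
  define Y where "Y = v ` {Suc i..n} \<union> w ` {1..<k}"
  have XY: "X \<inter> Y = {}"
  proof -
    have "v a \<noteq> v b" if "a \<le> i" "b \<in> {Suc i..n}" for a b
      using that i inj_onD[OF v, of a b] by auto
    moreover have "v a \<noteq> w b" if "a \<le> i" "b \<in> {1..<k}" for a b
      using that i k vw(2)[of a b] by auto
    moreover have "w a \<noteq> v b" if "a \<in> {k..Suc m}" "b \<in> {Suc i..n}" for a b
      using that i vw(1)[of b a] by auto
    moreover have "w a \<noteq> w b" if "a \<in> {k..Suc m}" "b \<in> {1..<k}" for a b
      using that k inj_onD[OF w, of a b] by auto
    ultimately show ?thesis unfolding X_def Y_def by blast
  qed
  let ?S = "{f \<in> H. f \<subseteq> X}" let ?T = "{f \<in> H. f \<subseteq> Y}"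
  have "?S \<inter> ?T = {}"
  proof (rule ccontr)
    assume "?S \<inter> ?T \<noteq> {}"
    then obtain f where "f \<in> H" "f \<subseteq> X" "f \<subseteq> Y" by blast
    then have "f = {}" using XY by blast
    then show False using H \<open>f \<in> H\<close> by simp
  qed
  moreover have "linked ?S (v 0) (v (Suc n))"
  proof -
    have "linked ?S (v 0) (v i)"
    proof (rule linked_chain[of 0 i])
      fix a assume "a < i"
      then show "{v a, v (Suc a)} \<in> ?S" using vE[of a] i by (auto simp: X_def)
    qed auto
    also have "linked ?S (v i) (w k)"
      using \<pi>(2)[OF i] k by (intro linked_edge) (auto simp: X_def k_def)
    also have "linked ?S (w k) (w (Suc m))"
    proof (rule linked_chain[of k "Suc m"])
      fix a assume "k \<le> a" "a < Suc m"
      then show "{w a, w (Suc a)} \<in> ?S" using wE[of a] by (auto simp: X_def)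
    qed (use k in auto)
    finally show ?thesis using ends by simp
  qed
  ultimately have "forest ?T" by (intro sep[of ?S ?T]) auto
  have jn: "j \<in> {1..n}" "l \<in> {1..n}" using jl by auto
  have \<pi>m: "\<pi> j \<in> {1..m}" "\<pi> l \<in> {1..m}" using im jn by auto
  \<comment> \<open>This rung is bypassed inside \<open>Y\<close>: along \<open>v\<close> to the
    other rung, across it, and back along \<open>w\<close>.\<close>
  let ?f = "{v j, w (\<pi> j)}"
  have f: "?f \<in> ?T" using \<pi>(2)[OF jn(1)] jl \<pi>m by (auto simp: Y_def)
  have "linked (?T - {?f}) (v j) (v l)"
  proof (rule linked_chain[of "Suc i" n])
    fix a assume a: "Suc i \<le> a" "a < n"
    have "w (\<pi> j) \<noteq> v a" "w (\<pi> j) \<noteq> v (Suc a)" using vw(2)[OF _ \<pi>m(1), of a] vw(2)[OF _ \<pi>m(1), of "Suc a"] a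
      by (metis Suc_leI le_SucI less_imp_le)+
    then have "{v a, v (Suc a)} \<noteq> ?f" by blast
    moreover have "{v a, v (Suc a)} \<in> ?T" using vE[of a] a by (auto simp: Y_def)
    ultimately show "{v a, v (Suc a)} \<in> ?T - {?f}" by simp
  qed (use jl in auto)
  also have "linked (?T - {?f}) (v l) (w (\<pi> l))"
  proof (rule linked_edge)
    have "v l \<noteq> v j" using inj_onD[OF v, of l j] jn jl by auto
    moreover have "v l \<noteq> w (\<pi> j)" using vw(1)[of l "\<pi> j"] jn \<pi>m by auto
    ultimately have "{v l, w (\<pi> l)} \<noteq> ?f" by blast
    moreover have "{v l, w (\<pi> l)} \<in> ?T" using \<pi>(2)[OF jn(2)] jl \<pi>m by (auto simp: Y_def)
    ultimately show "{v l, w (\<pi> l)} \<in> ?T - {?f}" by simp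
  qed
  also have "linked (?T - {?f}) (w (\<pi> l)) (w (\<pi> j))"
  proof (rule linked_chain[of 1 "k - 1"])
    fix a assume a: "1 \<le> a" "a < k - 1"
    have "v j \<noteq> w a" "v j \<noteq> w (Suc a)" using vw(1)[OF jn(1), of a] vw(1)[OF jn(1), of "Suc a"] a k by auto
    then have "{w a, w (Suc a)} \<noteq> ?f" by blast
    moreover have "{w a, w (Suc a)} \<in> ?T" using wE[of a] a k by (auto simp: Y_def)
    ultimately show "{w a, w (Suc a)} \<in> ?T - {?f}" by simp
  qed (use jl \<pi>m in auto)
  finally have "linked (?T - {?f}) (v j) (w (\<pi> j))" .
  moreover have "v j \<noteq> w (\<pi> j)" using vw(1)[of j "\<pi> j"] jn \<pi>m by auto
  ultimately show False using forestD[OF \<open>forest ?T\<close> f] by blast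
qed

text \<open>The \<open>i\<close> indices mapped into \<open>{1..i}\<close> are at most
  \<open>i + 1\<close>, as no index drops by more than one, and differ from \<open>i\<close>. So
  they include \<open>i + 1\<close>, whose image is at most \<open>i\<close> and, by the same bound,
  at least \<open>i\<close>.\<close>

lemma bij_betw_near_identity_swap:
  fixes \<pi> :: "nat \<Rightarrow> nat"
  assumes "bij_betw \<pi> {1..n} {1..n}" and near: "\<And>i. i \<in> {1..n} \<Longrightarrow> i \<le> Suc (\<pi> i)"
    and i: "i \<in> {1..n}" "\<pi> i = Suc i"
  shows "\<pi> (Suc i) = i"
proof -
  let ?A = "{j \<in> {1..n}. \<pi> j \<le> i}"
  have im: "\<pi> ` {1..n} = {1..n}" and inj: "inj_on \<pi> {1..n}" using assms(1) by (auto simp: bij_betw_def)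
  have "\<pi> ` ?A = \<pi> ` {1..n} \<inter> {..i}" by auto
  also have "\<dots> = {1..i}" using i unfolding im by auto
  finally have "\<pi> ` ?A = {1..i}" .
  moreover have "card (\<pi> ` ?A) = card ?A" by (rule card_image) (rule inj_on_subset[OF inj], auto)
  ultimately have "card ?A = i" by simp
  moreover have "?A \<subseteq> {1..Suc i} - {i}"
  proof
    fix j assume "j \<in> ?A"
    then show "j \<in> {1..Suc i} - {i}" using near[of j] i by auto
  qed
  moreover have "card ({1..Suc i} - {i}) = i" using i by (simp add: card_Diff_subset)
  ultimately have "?A = {1..Suc i} - {i}" by (intro card_subset_eq) auto
  then have "Suc i \<in> ?A" by auto
  then show ?thesis using near[of "Suc i"] by auto
qed

subsection \<open>Ladders\<close>

text \<open>\<open>S\<close> stands for the cycle through the special edge, without that edge, and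
  \<open>D\<close> for the other cycle. All that is kept of \<open>D\<close> is that it is nonempty
  and has no bridge, so it never meets a cut in a single edge.\<close>

lemma ladder_no_disjoint_cycle:
  fixes v w :: "nat \<Rightarrow> 'a" and \<sigma> :: "nat \<Rightarrow> nat"
  assumes v: "inj_on v {..Suc n}" and w: "inj_on w {..Suc n}"
    and vw: "\<And>i j. i \<le> Suc n \<Longrightarrow> j \<le> Suc n \<Longrightarrow> v i = w j \<longleftrightarrow> i = j \<and> (i = 0 \<or> i = Suc n)"
    and \<sigma>: "\<And>k. \<sigma> (\<sigma> k) = k" "\<And>k. \<sigma> k \<le> Suc k" "\<And>k. k \<notin> {1..n} \<Longrightarrow> \<sigma> k = k"
    and H: "H = {{v i, v (Suc i)} | i. i \<le> n} \<union> {{w i, w (Suc i)} | i. i \<le> n}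
      \<union> {{v k, w (\<sigma> k)} | k. k \<in> {1..n}}"
    and S: "S \<subseteq> H" "linked S (v 0) (v (Suc n))"
    and D: "D \<subseteq> H" "D \<noteq> {}" "\<And>a b. {a, b} \<in> D \<Longrightarrow> linked (D - {{a, b}}) a b"
    and disj: "S \<inter> D = {}"
  shows False
proof -
  have \<sigma>': "k \<le> Suc (\<sigma> k)" for k using \<sigma>(1)[of k] \<sigma>(2)[of "\<sigma> k"] by simp
  have \<sigma>n: "\<sigma> k \<in> {1..n} \<longleftrightarrow> k \<in> {1..n}" for k using \<sigma>(1)[of k] \<sigma>(3) by metis
  \<comment> \<open>The level is the index on either path. The paths share only their ends, where
    both indices agree, so preferring \<open>v\<close> does no harm.\<close>
  define lev where "lev x = (if x \<in> v ` {..Suc n} then the_inv_into {..Suc n} v x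
    else the_inv_into {..Suc n} w x)" for x
  have lev_v: "lev (v i) = i" if "i \<le> Suc n" for i
    using that by (simp add: lev_def the_inv_into_f_f[OF v])
  have lev_w: "lev (w i) = i" if "i \<le> Suc n" for i
  proof (cases "w i \<in> v ` {..Suc n}")
    case True
    then obtain j where "j \<le> Suc n" "w i = v j" by auto
    then show ?thesis using vw[of j i] lev_v[of j] that by metis
  next
    case False
    then show ?thesis using that by (simp add: lev_def the_inv_into_f_f[OF w])
  qed
  have v_inj: "v i = v j \<longleftrightarrow> i = j" if "i \<le> Suc n" "j \<le> Suc n" for i j
    using that v by (auto dest: inj_onD)
  have w_inj: "w i = w j \<longleftrightarrow> i = j" if "i \<le> Suc n" "j \<le> Suc n" for i j
    using that w by (auto dest: inj_onD)
  \<comment> \<open>These are the edges across the cut above level \<open>k\<close>: two path edges,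
    and two rungs if \<open>\<sigma>\<close> swaps \<open>k\<close> and
    \<open>Suc k\<close>.\<close>
  have cross: "c = v k \<and> d = v (Suc k) \<or> c = w k \<and> d = w (Suc k) \<or>
      \<sigma> k = Suc k \<and> (c = v k \<and> d = w (Suc k) \<or> c = w k \<and> d = v (Suc k))"
    if cd: "{c, d} \<in> H" "lev c \<le> k" "\<not> lev d \<le> k" for c d k
  proof -
    consider i where "{c, d} = {v i, v (Suc i)}" "i \<le> n" | i where "{c, d} = {w i, w (Suc i)}" "i \<le> n"
      | i where "{c, d} = {v i, w (\<sigma> i)}" "i \<in> {1..n}" using cd(1) unfolding H by blast
    then show ?thesis
    proof cases
      case (1 i)
      then have "c = v i \<and> d = v (Suc i) \<and> i = k" using cd lev_v[of i] lev_v[of "Suc i"]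
        by (auto simp: doubleton_eq_iff)
      then show ?thesis by simp
    next
      case (2 i)
      then have "c = w i \<and> d = w (Suc i) \<and> i = k" using cd lev_w[of i] lev_w[of "Suc i"]
        by (auto simp: doubleton_eq_iff)
      then show ?thesis by simp
    next
      case (3 i)
      then have *: "lev (v i) = i" "lev (w (\<sigma> i)) = \<sigma> i" using \<sigma>n[of i] by (auto intro!: lev_v lev_w)
      from 3 consider "c = v i" "d = w (\<sigma> i)" | "c = w (\<sigma> i)" "d = v i" by (auto simp: doubleton_eq_iff)
      then show ?thesis
      proof cases
        case 1
        then have "i = k" "\<sigma> i = Suc k" using * cd \<sigma>(2)[of i] by auto
        then show ?thesis using 1 by simp
      next
        case 2
        then have "i = Suc k" "\<sigma> i = k" using * cd \<sigma>'[of i] by auto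
        then show ?thesis using 2 \<sigma>(1)[of i] by simp
      qed
    qed
  qed
  have S_cross: "\<exists>c d. {c, d} \<in> S \<and> lev c \<le> k \<and> \<not> lev d \<le> k" if "k \<le> n" for k
  proof -
    have "v 0 \<in> {x. lev x \<le> k}" "v (Suc n) \<notin> {x. lev x \<le> k}"
      using that lev_v[of 0] lev_v[of "Suc n"] by auto
    from linked_crossing_edge[OF S(2) this] show ?thesis by blast
  qed
  have D_cross: "\<exists>c d. {c, d} \<in> D \<and> {c, d} \<noteq> {a, b} \<and> c \<in> X \<and> d \<notin> X"
    if "{a, b} \<in> D" "a \<in> X" "b \<notin> X" for a b X
    by (rule linked_crossing_edge[OF D(3)[OF that(1)] that(2,3)]) blast
  \<comment> \<open>The cut around a single vertex: \<open>D\<close> has no vertex of degree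
    one.\<close>
  have D_deg: "\<exists>b'. {a, b'} \<in> D \<and> b' \<noteq> b" if "{a, b} \<in> D" "a \<noteq> b" for a b
    using D_cross[of a b "{a}"] that by auto
  have nbr_v: "d = v (k - 1) \<or> d = v (Suc k) \<or> d = w (\<sigma> k)" if hk: "{v k, d} \<in> H" "k \<in> {1..n}" for k d
  proof -
    consider i where "{v k, d} = {v i, v (Suc i)}" "i \<le> n" | i where "{v k, d} = {w i, w (Suc i)}" "i \<le> n"
      | i where "{v k, d} = {v i, w (\<sigma> i)}" "i \<in> {1..n}" using hk(1) unfolding H by blast
    then show ?thesis
    proof cases
      case (1 i)
      then show ?thesis using hk by (auto simp: doubleton_eq_iff v_inj)
    next
      case (2 i)
      then show ?thesis using hk vw[of k i] vw[of k "Suc i"] by (auto simp: doubleton_eq_iff)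
    next
      case (3 i)
      then have "v k \<noteq> w (\<sigma> i)" using hk vw[of k "\<sigma> i"] \<sigma>n[of i] by auto
      then have "v k = v i" "d = w (\<sigma> i)" using 3 by (auto simp: doubleton_eq_iff)
      then show ?thesis using v_inj[of k i] 3 hk by auto
    qed
  qed
  have nbr_w: "d = w (k - 1) \<or> d = w (Suc k) \<or> d = v (\<sigma> k)" if hk: "{w k, d} \<in> H" "k \<in> {1..n}" for k d
  proof -
    have wv: "w k \<noteq> v j" if "j \<le> Suc n" for j
    proof
      assume "w k = v j"
      then have "v j = w k" by (rule sym)
      with vw[OF that, of k] hk(2) show False by auto
    qed
    consider i where "{w k, d} = {v i, v (Suc i)}" "i \<le> n" | i where "{w k, d} = {w i, w (Suc i)}" "i \<le> n"
      | i where "{w k, d} = {v i, w (\<sigma> i)}" "i \<in> {1..n}" using hk(1) unfolding H by blast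
    then show ?thesis
    proof cases
      case (1 i)
      then show ?thesis using wv[of i] wv[of "Suc i"] by (simp add: doubleton_eq_iff)
    next
      case (2 i)
      then show ?thesis using hk by (auto simp: doubleton_eq_iff w_inj)
    next
      case (3 i)
      then have "w k \<noteq> v i" using wv[of i] by simp
      then have "w k = w (\<sigma> i)" "d = v i" using 3 by (simp_all add: doubleton_eq_iff)
      moreover from 3 hk have "k \<le> Suc n" "\<sigma> i \<le> Suc n" using \<sigma>n[of i] by simp_all
      ultimately show ?thesis using w_inj[of k "\<sigma> i"] \<sigma>(1)[of i] by simp
    qed
  qed
  \<comment> \<open>Without crossed rungs the cut has two edges. \<open>D\<close> would need both,
    but \<open>S\<close> takes one of them.\<close>
  have A: "{v k, v (Suc k)} \<notin> D \<and> {w k, w (Suc k)} \<notin> D" if "k \<le> n" "\<sigma> k \<noteq> Suc k" for k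
  proof -
    have both: "{v k, v (Suc k)} \<in> D \<and> {w k, w (Suc k)} \<in> D"
      if ab: "{a, b} \<in> D" "lev a \<le> k" "\<not> lev b \<le> k" for a b
    proof -
      obtain c d where cd: "{c, d} \<in> D" "{c, d} \<noteq> {a, b}" "lev c \<le> k" "\<not> lev d \<le> k"
        using D_cross[of a b "{x. lev x \<le> k}"] ab by auto
      then show ?thesis
        using cross[of c d k] cross[of a b k] ab D(1) \<open>\<sigma> k \<noteq> Suc k\<close> by auto
    qed
    obtain c d where cd: "{c, d} \<in> S" "lev c \<le> k" "\<not> lev d \<le> k" using S_cross \<open>k \<le> n\<close> by blast
    then have "{c, d} = {v k, v (Suc k)} \<or> {c, d} = {w k, w (Suc k)}"
      using cross[of c d k] S(1) \<open>\<sigma> k \<noteq> Suc k\<close> by auto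
    then have "\<not> ({v k, v (Suc k)} \<in> D \<and> {w k, w (Suc k)} \<in> D)"
      using cd disj by auto
    then show ?thesis
      using both[of "v k" "v (Suc k)"] both[of "w k" "w (Suc k)"] \<open>k \<le> n\<close>
        lev_v[of k] lev_v[of "Suc k"] lev_w[of k] lev_w[of "Suc k"] by auto
  qed
  \<comment> \<open>The same cut seen from its upper level; \<open>k\<close> is positive, so
    \<open>k - 1\<close> is the true predecessor.\<close>
  have A': "{v k, v (k - 1)} \<notin> D \<and> {w k, w (k - 1)} \<notin> D" if "k \<in> {1..n}" "\<sigma> k \<noteq> k - 1" for k
  proof -
    obtain j where j: "k = Suc j" using \<open>k \<in> {1..n}\<close> by (cases k) auto
    then have "\<sigma> j \<noteq> Suc j" using \<sigma>(1)[of j] that by auto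
    then show ?thesis using A[of j] that j by (simp add: insert_commute)
  qed
  \<comment> \<open>Neither path edge at \<open>v k\<close> is in \<open>D\<close>, so the rung
    would be the only edge of \<open>D\<close> there.\<close>
  have B: "{v k, w k} \<notin> D" if "k \<in> {1..n}" "\<sigma> k = k" for k
  proof
    assume "{v k, w k} \<in> D"
    moreover have "v k \<noteq> w k" using vw[of k k] that by auto
    ultimately obtain b where "{v k, b} \<in> D" "b \<noteq> w k" using D_deg by blast
    moreover from this have "{v k, b} \<in> H" using D(1) by blast
    moreover have "\<sigma> k \<noteq> k - 1" using that by auto
    ultimately show False using nbr_v[of k b] A[of k] A'[of k] that by auto
  qed
  \<comment> \<open>The cuts below and above contain no edge of \<open>D\<close>, so at the four
    vertices \<open>D\<close> can use only the four crossing edges. Having no vertex of degree one,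
    it uses all of them or none, and \<open>S\<close> takes one.\<close>
  have C: "{v k, v (Suc k)} \<notin> D \<and> {w k, w (Suc k)} \<notin> D \<and> {v k, w (Suc k)} \<notin> D \<and> {v (Suc k), w k} \<notin> D"
    if k: "\<sigma> k = Suc k" for k
  proof -
    have kn: "k \<in> {1..n}" "Suc k \<in> {1..n}" using \<sigma>(3)[of k] k \<sigma>n[of k] by auto
    have k': "\<sigma> (Suc k) = k" using \<sigma>(1)[of k] k by simp
    have nk: "\<sigma> k \<noteq> k - 1" using k by auto
    have ne: "v k \<noteq> v (Suc k)" "w k \<noteq> w (Suc k)" "v k \<noteq> w (Suc k)" "v (Suc k) \<noteq> w k"
      using kn v_inj[of k "Suc k"] w_inj[of k "Suc k"] vw[of k "Suc k"] vw[of "Suc k" k] by auto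
    have 1: "d = v (Suc k) \<or> d = w (Suc k)" if "{v k, d} \<in> D" for d
      using nbr_v[OF subsetD[OF D(1) that] kn(1)] A'[OF kn(1) nk] that k by auto
    have 2: "d = w (Suc k) \<or> d = v (Suc k)" if "{w k, d} \<in> D" for d
      using nbr_w[OF subsetD[OF D(1) that] kn(1)] A'[OF kn(1) nk] that k by auto
    have 3: "d = v k \<or> d = w k" if "{v (Suc k), d} \<in> D" for d
      using nbr_v[OF subsetD[OF D(1) that] kn(2)] A[of "Suc k"] that kn k' by auto
    have 4: "d = w k \<or> d = v k" if "{w (Suc k), d} \<in> D" for d
      using nbr_w[OF subsetD[OF D(1) that] kn(2)] A[of "Suc k"] that kn k' by auto
    have e1: "{v k, v (Suc k)} \<in> D \<longleftrightarrow> {v k, w (Suc k)} \<in> D"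
      using D_deg[of "v k" "v (Suc k)"] D_deg[of "v k" "w (Suc k)"] 1 ne by metis
    have e2: "{w k, v (Suc k)} \<in> D \<longleftrightarrow> {w k, w (Suc k)} \<in> D"
      using D_deg[of "w k" "v (Suc k)"] D_deg[of "w k" "w (Suc k)"] 2 ne by metis
    have e3: "{v (Suc k), v k} \<in> D \<longleftrightarrow> {v (Suc k), w k} \<in> D"
      using D_deg[of "v (Suc k)" "v k"] D_deg[of "v (Suc k)" "w k"] 3 ne by metis
    obtain c d where cd: "{c, d} \<in> S" "lev c \<le> k" "\<not> lev d \<le> k" using S_cross[of k] kn by auto
    then have "{c, d} = {v k, v (Suc k)} \<or> {c, d} = {w k, w (Suc k)} \<or> {c, d} = {v k, w (Suc k)}
      \<or> {c, d} = {w k, v (Suc k)}"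
      using cross[of c d k] S(1) by auto
    moreover have "{c, d} \<notin> D" using cd disj by auto
    ultimately have "{v k, v (Suc k)} \<notin> D \<or> {w k, w (Suc k)} \<notin> D \<or> {v k, w (Suc k)} \<notin> D
      \<or> {w k, v (Suc k)} \<notin> D" by metis
    moreover have "{v (Suc k), v k} = {v k, v (Suc k)}" "{v (Suc k), w k} = {w k, v (Suc k)}" by auto
    ultimately show ?thesis using e1 e2 e3 by simp
  qed
  obtain f where "f \<in> D" using D(2) by auto
  then consider i where "f = {v i, v (Suc i)}" "i \<le> n" | i where "f = {w i, w (Suc i)}" "i \<le> n"
    | i where "f = {v i, w (\<sigma> i)}" "i \<in> {1..n}" using D(1) unfolding H by blast
  then show False
  proof cases
    case (1 i)
    then show ?thesis using A[of i] C[of i] \<open>f \<in> D\<close> by blast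
  next
    case (2 i)
    then show ?thesis using A[of i] C[of i] \<open>f \<in> D\<close> by blast
  next
    case (3 i)
    consider "\<sigma> i = i" | "\<sigma> i = Suc i" | "Suc (\<sigma> i) = i" using \<sigma>(2)[of i] \<sigma>'[of i] by linarith
    then show ?thesis
    proof cases
      \<comment> \<open>A rung going down from \<open>i\<close> belongs to the crossed pair that
        begins at \<open>\<sigma> i\<close>.\<close>
      case 3
      then show ?thesis using C[of "\<sigma> i"] \<sigma>(1)[of i] \<open>f \<in> D\<close> \<open>f = _\<close> by auto
    qed (use B[of i] C[of i] 3 \<open>f \<in> D\<close> in auto)
  qed
qed

section \<open>Ladder decompositions of graphs\<close>

lemma path_interior:
  assumes "distinct p" "p \<noteq> []" "hd p = a" "last p = b" "a \<noteq> b"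
  obtains n where "length p = Suc (Suc n)" "p ! 0 = a" "p ! Suc n = b" "set p - {a, b} = (!) p ` {1..n}"
proof -
  obtain n where n: "length p = Suc (Suc n)"
  proof (cases p)
    case (Cons x xs)
    then show ?thesis using assms that by (cases xs) auto
  qed (use assms in auto)
  have ends: "p ! 0 = a" "p ! Suc n = b"
    using assms n by (auto simp: hd_conv_nth last_conv_nth)
  have "set p = (!) p ` {..Suc n}" using n by (auto simp: set_conv_nth image_iff less_Suc_eq_le)
  also have "{..Suc n} = {0, Suc n} \<union> {1..n}" by auto
  finally have "set p = {a, b} \<union> (!) p ` {1..n}" using ends by auto
  moreover have "p ! i \<noteq> a \<and> p ! i \<noteq> b" if "i \<in> {1..n}" for i
    using nth_eq_iff_index_eq[OF assms(1), of i 0] nth_eq_iff_index_eq[OF assms(1), of i "Suc n"] that n ends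
    by auto
  ultimately have "set p - {a, b} = (!) p ` {1..n}" by blast
  then show ?thesis using that n ends by blast
qed

lemma path_edges_nth_length:
  "length p = Suc (Suc n) \<Longrightarrow> path_edges p = {{p ! i, p ! Suc i} | i. i \<le> n}"
  by (auto simp: path_edges_nth less_Suc_eq_le)

text \<open>The involution \<open>\<sigma>\<close> encodes the family of pairs: it swaps the two
  members of each pair and fixes everything else. Every rung then has the same form. Being an
  involution, \<open>\<sigma>\<close> also cannot lower an index by more than one.\<close>

definition ladder_decomposition ::
  "'a set \<Rightarrow> 'a set set \<Rightarrow> 'a \<Rightarrow> 'a \<Rightarrow> nat \<Rightarrow> 'a list \<Rightarrow> 'a list \<Rightarrow> (nat \<Rightarrow> nat) \<Rightarrow> bool" where
  "ladder_decomposition V E a b n p q \<sigma> \<longleftrightarrow>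
     length p = Suc (Suc n) \<and> length q = Suc (Suc n) \<and>
     is_path V E a p b \<and> is_path V E a q b \<and> set p \<inter> set q = {a, b} \<and>
     {a, b} \<notin> path_edges p \<and> {a, b} \<notin> path_edges q \<and>
     (\<forall>k. \<sigma> (\<sigma> k) = k) \<and> (\<forall>k. \<sigma> k \<le> Suc k) \<and> (\<forall>k. k \<notin> {1..n} \<longrightarrow> \<sigma> k = k) \<and>
     V = set p \<union> set q \<and>
     E = {{p ! k, q ! \<sigma> k} | k. k \<in> {1..n}} \<union> path_edges p \<union> path_edges q \<union> {{a, b}}"

text \<open>No edge of a cycle is a bridge of it. Hence the cycle through \<open>{a, b}\<close>
  still links \<open>a\<close> and \<open>b\<close> without that edge, and the other cycle is
  bridge-free, as the cut argument demands.\<close>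

lemma ladder_decomposition_no_disjoint_cycles:
  assumes "ladder_decomposition V E a b n p q \<sigma>" "a \<noteq> b"
  shows "no_disjoint_cycles_through V E {a, b}"
proof -
  note L = assms(1)[unfolded ladder_decomposition_def is_path_def]
  have len: "length p = Suc (Suc n)" "length q = Suc (Suc n)" using L by auto
  have ends: "p ! 0 = a" "q ! 0 = a" "p ! Suc n = b" "q ! Suc n = b"
    using L len by (metis hd_conv_nth last_conv_nth diff_Suc_1)+
  have dist: "distinct p" "distinct q" using L by auto
  let ?H = "{{p ! i, p ! Suc i} | i. i \<le> n} \<union> {{q ! i, q ! Suc i} | i. i \<le> n}
      \<union> {{p ! k, q ! \<sigma> k} | k. k \<in> {1..n}}"
  have E: "E = insert {a, b} ?H"
    using L path_edges_nth_length[OF len(1)] path_edges_nth_length[OF len(2)] by auto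
  have inj: "inj_on ((!) p) {..Suc n}" "inj_on ((!) q) {..Suc n}"
    using dist len by (auto simp: inj_on_def nth_eq_iff_index_eq)
  have idx: "p ! i = a \<longleftrightarrow> i = 0" "p ! i = b \<longleftrightarrow> i = Suc n" "q ! i = a \<longleftrightarrow> i = 0" "q ! i = b \<longleftrightarrow> i = Suc n"
    if "i \<le> Suc n" for i
    using nth_eq_iff_index_eq[OF dist(1), of i 0] nth_eq_iff_index_eq[OF dist(1), of i "Suc n"]
      nth_eq_iff_index_eq[OF dist(2), of i 0] nth_eq_iff_index_eq[OF dist(2), of i "Suc n"]
      that len ends by auto
  have vw: "p ! i = q ! j \<longleftrightarrow> i = j \<and> (i = 0 \<or> i = Suc n)" if ij: "i \<le> Suc n" "j \<le> Suc n" for i j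
  proof
    assume eq: "p ! i = q ! j"
    have "p ! i \<in> set p" "q ! j \<in> set q" using ij len by auto
    then have "p ! i \<in> {a, b}" using eq L by auto
    then show "i = j \<and> (i = 0 \<or> i = Suc n)" using idx[OF ij(1)] idx[OF ij(2)] eq by auto
  next
    assume "i = j \<and> (i = 0 \<or> i = Suc n)"
    then show "p ! i = q ! j" using ends by auto
  qed
  have *: False
    if C: "is_cycle V E C" and D: "is_cycle V E D" and "cycle_edges C \<inter> cycle_edges D = {}"
      and e: "{a, b} \<in> cycle_edges C" for C D
  proof (rule ladder_no_disjoint_cycle[OF inj vw _ _ _ refl])
    show "cycle_edges C - {{a, b}} \<subseteq> ?H" using C E unfolding is_cycle_def by blast
    show "linked (cycle_edges C - {{a, b}}) (p ! 0) (p ! Suc n)"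
      using cycle_edge_not_bridge[OF C e] ends by simp
    have "{a, b} \<notin> cycle_edges D" using that by blast
    then show "cycle_edges D \<subseteq> ?H" using D E unfolding is_cycle_def by blast
    have "D \<noteq> []" using D by (auto simp: is_cycle_def)
    then show "cycle_edges D \<noteq> {}" by (simp add: cycle_edges_closing)
    show "linked (cycle_edges D - {{x, y}}) x y" if "{x, y} \<in> cycle_edges D" for x y
      using cycle_edge_not_bridge[OF D that] .
    show "(cycle_edges C - {{a, b}}) \<inter> cycle_edges D = {}" using that by blast
  qed (use L in auto)
  show ?thesis unfolding no_disjoint_cycles_through_def
    using * by (metis Int_commute Un_iff)
qed

lemma no_disjoint_cycles_ladder_decomposition:
  assumes G: "simple_graph V E" "k_connected 3 V E" and e: "{a, b} \<in> E"
    and nc: "no_disjoint_cycles_through V E {a, b}"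
  obtains n p q \<sigma> where "ladder_decomposition V E a b n p q \<sigma>"
proof -
  have G': "finite V" "\<And>f. f \<in> E \<Longrightarrow> f \<subseteq> V \<and> card f = 2" using G(1) by (auto simp: simple_graph_def)
  have ab: "a \<in> V" "b \<in> V" "a \<noteq> b" using G'(2)[OF e] by auto
  define H where "H = E - {{a, b}}"
  have HE: "H \<subseteq> E" by (auto simp: H_def)
  have "3 < card V" using G(2) by (simp add: k_connected_def)
  moreover have "card {a, b} \<le> 2" by (simp add: card_insert_if)
  ultimately have "\<not> V \<subseteq> {a, b}" using card_mono[of "{a, b}" V] by auto
  \<comment> \<open>Linkage without \<open>{a, b}\<close> is known only with some vertex removed as
    well, so a third vertex serves for that.\<close>
  then obtain x0 where x0: "x0 \<in> V" "x0 \<noteq> a" "x0 \<noteq> b" by auto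
  have "linked {f \<in> H. x0 \<notin> f} b a"
    using three_connected_delete_edge_linked[OF G e x0(1,2) ab(2)] x0 by (auto simp: H_def)
  then have "linked H b a" by (rule linked_mono) auto
  then have Hab: "linked H a b" by (rule linked_sym)
  have conn: "linked {f \<in> H. x \<notin> f} y a" if "x \<noteq> a" "{x, y} \<in> H" for x y
  proof -
    have "{x, y} \<subseteq> V" "card {x, y} = 2" using that(2) HE G'(2)[of "{x, y}"] by auto
    then have "x \<in> V" "y \<in> V" "y \<noteq> x" by auto
    then show ?thesis
      using three_connected_delete_edge_linked[OF G e, of x y] that(1) by (simp add: H_def)
  qed
  have H2: "\<forall>f\<in>H. card f = 2" using HE G' by auto
  obtain p q where p: "p \<noteq> []" "hd p = a" "last p = b" "distinct p" "path_edges p \<subseteq> H"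
    and q: "q \<noteq> []" "hd q = a" "last q = b" "distinct q" "path_edges q \<subseteq> H"
    and pq: "set p \<inter> set q = {a, b}"
    by (rule two_internally_disjoint_paths[OF conn H2 Hab ab(3)])
  obtain n where n: "length p = Suc (Suc n)" "p ! 0 = a" "p ! Suc n = b" "set p - {a, b} = (!) p ` {1..n}"
    using path_interior[OF p(4,1,2,3) ab(3)] .
  obtain m where m: "length q = Suc (Suc m)" "q ! 0 = a" "q ! Suc m = b" "set q - {a, b} = (!) q ` {1..m}"
    using path_interior[OF q(4,1,2,3) ab(3)] .
  have "\<Union>H \<subseteq> V" using HE G'(2) by blast
  then have sub: "set p \<subseteq> V" "set q \<subseteq> V"
    using set_subset_Union_path_edges[of p] set_subset_Union_path_edges[of q] n(1) m(1)
      Union_mono[OF p(5)] Union_mono[OF q(5)] by auto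
  have sep: "forest T" if "S \<subseteq> H" "T \<subseteq> H" "S \<inter> T = {}" "linked S a b" for S T
    using no_disjoint_cycles_forest[OF G(1) e nc] that by (simp add: H_def)
  have link: "linked (path_edges p) a b" "linked (path_edges q) a b"
    using linked_path_edges[OF p(1)] linked_path_edges[OF q(1)] p q by auto
  have forest: "forest (H - path_edges p)" "forest (H - path_edges q)"
    using sep[OF p(5) _ _ link(1), of "H - path_edges p"] sep[OF q(5) _ _ link(2), of "H - path_edges q"] by auto
  define F where "F = H - path_edges p - path_edges q"
  have F': "F = H - path_edges q - path_edges p" by (auto simp: F_def)
  have qp: "set q \<inter> set p = {a, b}" using pq by blast
  note deg = k_connected_min_degree[OF G]
  \<comment> \<open>The matching lemma is used with the paths in both roles, which yields mutually
    inverse maps \<open>\<pi>\<close> and \<open>\<rho>\<close> between the interior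
    indices.\<close>
  note M = off_path_edges_matching[OF G(1) deg H_def e p(4,5) forest(1) q(4,5) forest(2) pq F_def]
  note M' = off_path_edges_matching[OF G(1) deg H_def e q(4,5) forest(2) p(4,5) forest(1) qp F']
  have V: "V = set p \<union> set q" using M(1) sub by auto
  have "\<forall>i\<in>{1..n}. \<exists>j\<in>{1..m}. nbrs F (p ! i) = {q ! j}"
  proof
    fix i assume "i \<in> {1..n}"
    then have "p ! i \<in> set p - {a, b}" using n(4) by auto
    then show "\<exists>j\<in>{1..m}. nbrs F (p ! i) = {q ! j}" using M(3)[of "p ! i"] sub m(4) by auto
  qed
  then obtain \<pi> where \<pi>: "\<And>i. i \<in> {1..n} \<Longrightarrow> \<pi> i \<in> {1..m} \<and> nbrs F (p ! i) = {q ! \<pi> i}" by metis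
  have "\<forall>j\<in>{1..m}. \<exists>i\<in>{1..n}. nbrs F (q ! j) = {p ! i}"
  proof
    fix j assume "j \<in> {1..m}"
    then have "q ! j \<in> set q - {a, b}" using m(4) by auto
    then show "\<exists>i\<in>{1..n}. nbrs F (q ! j) = {p ! i}" using M'(3)[of "q ! j"] sub n(4) by auto
  qed
  then obtain \<rho> where \<rho>: "\<And>j. j \<in> {1..m} \<Longrightarrow> \<rho> j \<in> {1..n} \<and> nbrs F (q ! j) = {p ! \<rho> j}" by metis
  have \<pi>F: "{p ! i, q ! \<pi> i} \<in> F" if "i \<in> {1..n}" for i using \<pi>[OF that] by (auto simp: nbrs_def)
  have \<rho>F: "{q ! j, p ! \<rho> j} \<in> F" if "j \<in> {1..m}" for j using \<rho>[OF that] by (auto simp: nbrs_def)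
  have \<rho>\<pi>: "\<rho> (\<pi> i) = i" if i: "i \<in> {1..n}" for i
  proof -
    have "p ! i \<in> nbrs F (q ! \<pi> i)" using \<pi>F[OF i] by (simp add: nbrs_def insert_commute)
    then have "p ! i = p ! \<rho> (\<pi> i)" using \<rho> \<pi>[OF i] by blast
    moreover have "i < length p" "\<rho> (\<pi> i) < length p" using i \<rho>[of "\<pi> i"] \<pi>[OF i] n(1) by auto
    ultimately show ?thesis using nth_eq_iff_index_eq[OF p(4)] by metis
  qed
  have \<pi>\<rho>: "\<pi> (\<rho> j) = j" if j: "j \<in> {1..m}" for j
  proof -
    have "q ! j \<in> nbrs F (p ! \<rho> j)" using \<rho>F[OF j] by (simp add: nbrs_def insert_commute)
    then have "q ! j = q ! \<pi> (\<rho> j)" using \<pi> \<rho>[OF j] by blast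
    moreover have "j < length q" "\<pi> (\<rho> j) < length q" using j \<pi>[of "\<rho> j"] \<rho>[OF j] m(1) by auto
    ultimately show ?thesis using nth_eq_iff_index_eq[OF q(4)] by metis
  qed
  have bij: "bij_betw \<pi> {1..n} {1..m}"
    by (rule bij_betw_byWitness[of _ \<rho>]) (use \<rho>\<pi> \<pi>\<rho> \<pi> \<rho> in auto)
  have bij': "bij_betw \<rho> {1..m} {1..n}"
    by (rule bij_betw_byWitness[of _ \<pi>]) (use \<rho>\<pi> \<pi>\<rho> \<pi> \<rho> in auto)
  have nm: "m = n" using bij_betw_same_card[OF bij] by simp
  have inj: "inj_on ((!) p) {..Suc n}" "inj_on ((!) q) {..Suc m}"
    using p(4) q(4) n(1) m(1) by (auto simp: inj_on_def nth_eq_iff_index_eq)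
  have pE: "{p ! i, p ! Suc i} \<in> H" if "i \<le> n" for i
    using p(5) path_edges_nth_length[OF n(1)] that by blast
  have qE: "{q ! i, q ! Suc i} \<in> H" if "i \<le> m" for i
    using q(5) path_edges_nth_length[OF m(1)] that by blast
  have vw1: "p ! i \<noteq> q ! j" if "i \<in> {1..n}" "j \<le> Suc m" for i j
  proof -
    have "p ! i \<in> set p - {a, b}" "q ! j \<in> set q" using n(4) m(1) that by auto
    then have "p ! i \<notin> set q" "q ! j \<in> set q" using pq by blast+
    then show ?thesis by metis
  qed
  have vw2: "p ! i \<noteq> q ! j" if "i \<le> Suc n" "j \<in> {1..m}" for i j
  proof -
    have "q ! j \<in> set q - {a, b}" "p ! i \<in> set p" using m(4) n(1) that by auto
    then have "q ! j \<notin> set p" "p ! i \<in> set p" using pq by blast+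
    then show ?thesis by metis
  qed
  have "{} \<notin> H" using H2 by auto
  have FH: "F \<subseteq> H" by (auto simp: F_def)
  have \<pi>_le: "\<pi> i \<le> Suc i" if "i \<in> {1..n}" for i
  proof (rule rung_not_long[where v = "(!) p" and w = "(!) q", OF _ _ inj vw1 vw2 pE qE bij _ \<open>{} \<notin> H\<close>])
    show "forest T" if "S \<subseteq> H" "T \<subseteq> H" "S \<inter> T = {}" "linked S (p ! 0) (p ! Suc n)" for S T
      using sep that n by auto
  qed (use n m \<pi>F FH that in auto)
  \<comment> \<open>Exchanging the paths bounds the inverse map, which means that
    \<open>\<pi>\<close> lowers no index by more than one.\<close>
  have \<rho>_le: "\<rho> j \<le> Suc j" if "j \<in> {1..m}" for j
  proof (rule rung_not_long[where v = "(!) q" and w = "(!) p", OF _ _ inj(2,1) _ _ qE pE bij' _ \<open>{} \<notin> H\<close>])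
    show "forest T" if "S \<subseteq> H" "T \<subseteq> H" "S \<inter> T = {}" "linked S (q ! 0) (q ! Suc m)" for S T
      using sep that m by auto
    show "q ! i \<noteq> p ! j" if "i \<in> {1..m}" "j \<le> Suc n" for i j using vw2[OF that(2,1)] by simp
    show "q ! i \<noteq> p ! j" if "i \<le> Suc m" "j \<in> {1..n}" for i j using vw1[OF that(2,1)] by simp
  qed (use n m \<rho>F FH that in auto)
  have ge: "i \<le> Suc (\<pi> i)" if "i \<in> {1..n}" for i using \<rho>_le[of "\<pi> i"] \<pi>[OF that] \<rho>\<pi>[OF that] by simp
  have ge': "i \<le> Suc (\<rho> i)" if "i \<in> {1..m}" for i using \<pi>_le[of "\<rho> i"] \<rho>[OF that] \<pi>\<rho>[OF that] by simp
  have inv: "\<pi> (\<pi> i) = i" if i: "i \<in> {1..n}" for i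
  proof -
    consider "\<pi> i = i" | "\<pi> i = Suc i" | "Suc (\<pi> i) = i" using \<pi>_le[OF i] ge[OF i] by linarith
    then show ?thesis
    proof cases
      case 2
      then show ?thesis using bij_betw_near_identity_swap[OF bij[unfolded nm] ge i] by simp
    next
      case 3
      \<comment> \<open>Where \<open>\<pi>\<close> lowers \<open>i\<close> by one,
        \<open>\<rho>\<close> raises \<open>\<pi> i\<close> by one, so the swap argument applies to
        the inverse.\<close>
      have "\<rho> (Suc (\<pi> i)) = \<pi> i"
        by (rule bij_betw_near_identity_swap[OF bij'[unfolded nm] ge'[unfolded nm]])
          (use \<pi>[OF i] \<rho>\<pi>[OF i] nm 3 in auto)
      then have "\<pi> (\<pi> i) = \<pi> (\<rho> i)" using 3 by simp
      then show ?thesis using \<pi>\<rho>[of i] i nm by simp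
    qed simp
  qed
  \<comment> \<open>Extended by the identity, because the decomposition asks for an involution of
    all natural numbers.\<close>
  define \<sigma> where "\<sigma> k = (if k \<in> {1..n} then \<pi> k else k)" for k
  have \<sigma>: "\<sigma> (\<sigma> k) = k" "\<sigma> k \<le> Suc k" "k \<notin> {1..n} \<Longrightarrow> \<sigma> k = k" for k
    using \<pi>[of k] inv[of k] \<pi>_le[of k] nm by (auto simp: \<sigma>_def)
  \<comment> \<open>An end \<open>x\<close> of an edge of \<open>F\<close> is interior to one of the
    paths, and its only neighbour in \<open>F\<close> is its partner under \<open>\<pi>\<close> or
    \<open>\<rho>\<close>.\<close>
  have rungs: "F = {{p ! k, q ! \<sigma> k} | k. k \<in> {1..n}}"
  proof (intro equalityI subsetI)
    fix f assume f: "f \<in> F"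
    then have "card f = 2" using H2 FH by auto
    then obtain x y where xy: "f = {x, y}" by (auto simp: card_2_iff)
    have "x \<in> V" using f xy FH HE G'(2) by blast
    have y: "y \<in> nbrs F x" using f xy by (simp add: nbrs_def)
    then have "x \<notin> {a, b}" using M(2)[of x] by blast
    then have "x \<in> (!) p ` {1..n} \<or> x \<in> (!) q ` {1..m}"
      using \<open>x \<in> V\<close> V unfolding n(4)[symmetric] m(4)[symmetric] by blast
    then consider i where "i \<in> {1..n}" "x = p ! i" | j where "j \<in> {1..m}" "x = q ! j"
      by blast
    then show "f \<in> {{p ! k, q ! \<sigma> k} | k. k \<in> {1..n}}"
    proof cases
      case (1 i)
      then have "f = {p ! i, q ! \<sigma> i}" using \<pi>[of i] y xy by (simp add: \<sigma>_def)
      then show ?thesis using 1 by blast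
    next
      case (2 j)
      then have "f = {p ! \<rho> j, q ! \<sigma> (\<rho> j)}" using \<rho>[of j] \<pi>\<rho>[of j] y xy by (auto simp: \<sigma>_def)
      then show ?thesis using \<rho>[of j] 2 by blast
    qed
  qed (use \<pi>F in \<open>auto simp: \<sigma>_def\<close>)
  have "E = F \<union> path_edges p \<union> path_edges q \<union> {{a, b}}"
    using p(5) q(5) e by (auto simp: F_def H_def)
  then have "E = {{p ! k, q ! \<sigma> k} | k. k \<in> {1..n}} \<union> path_edges p \<union> path_edges q \<union> {{a, b}}"
    unfolding rungs .
  then have "ladder_decomposition V E a b n p q \<sigma>"
    unfolding ladder_decomposition_def is_path_def
    using n(1) m(1) nm p q sub pq V \<sigma> by (auto simp: H_def)
  then show ?thesis by (rule that)
qed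

section \<open>Families of consecutive pairs as involutions\<close>

text \<open>Pairs are unordered, so the two crossed families coincide; each consists of the rungs at
  indices moved by \<open>\<sigma>\<close>, and the straight family of those at fixed
  indices.\<close>

lemma rung_edges_eq:
  assumes P: "\<And>i j. {i, j} \<in> P \<longleftrightarrow> i \<in> {1..n} \<and> j = \<sigma> i \<and> i \<noteq> j"
    and UP: "\<And>k. k \<in> \<Union>P \<longleftrightarrow> k \<in> {1..n} \<and> \<sigma> k \<noteq> k"
  shows "{{v i, w j} | i j. {i, j} \<in> P} \<union> {{v j, w i} | i j. {i, j} \<in> P}
    \<union> {{v k, w k} | k. k \<in> {1..n} \<and> k \<notin> \<Union>P} = {{v k, w (\<sigma> k)} | k. k \<in> {1..n}}"
proof -
  have "{i, j} \<in> P \<Longrightarrow> {j, i} \<in> P" for i j by (simp add: insert_commute)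
  then have "{{v j, w i} | i j. {i, j} \<in> P} = {{v i, w j} | i j. {i, j} \<in> P}"
    by blast
  moreover have "{{v i, w j} | i j. {i, j} \<in> P} = {{v k, w (\<sigma> k)} | k. k \<in> {1..n} \<and> \<sigma> k \<noteq> k}"
    unfolding P by (intro Collect_cong) metis
  moreover have "{{v k, w k} | k. k \<in> {1..n} \<and> k \<notin> \<Union>P} = {{v k, w (\<sigma> k)} | k. k \<in> {1..n} \<and> \<sigma> k = k}"
    unfolding UP by (intro Collect_cong) metis
  moreover have "{{v k, w (\<sigma> k)} | k. k \<in> {1..n}} = {{v k, w (\<sigma> k)} | k. k \<in> {1..n} \<and> \<sigma> k \<noteq> k}
    \<union> {{v k, w (\<sigma> k)} | k. k \<in> {1..n} \<and> \<sigma> k = k}" by blast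
  ultimately show ?thesis by (simp only: Un_absorb)
qed

text \<open>\<open>P\<close> consists of the two-element orbits of \<open>\<sigma>\<close>. Orbits
  are disjoint, and the bound on \<open>\<sigma>\<close> makes their members consecutive.\<close>

lemma adjacent_pairs_of_involution:
  fixes \<sigma> :: "nat \<Rightarrow> nat"
  assumes \<sigma>: "\<And>k. \<sigma> (\<sigma> k) = k" "\<And>k. \<sigma> k \<le> Suc k" "\<And>k. k \<notin> {1..n} \<Longrightarrow> \<sigma> k = k"
  obtains P where "P \<subseteq> {{i, i + 1} | i. 1 \<le> i \<and> i + 1 \<le> n}" "pairwise disjnt P"
    "\<And>i j. {i, j} \<in> P \<longleftrightarrow> i \<in> {1..n} \<and> j = \<sigma> i \<and> i \<noteq> j"
    "\<And>k. k \<in> \<Union>P \<longleftrightarrow> k \<in> {1..n} \<and> \<sigma> k \<noteq> k"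
proof -
  define P where "P = {{k, \<sigma> k} | k. \<sigma> k \<noteq> k}"
  have in_range: "k \<in> {1..n} \<and> \<sigma> k \<in> {1..n}" if "\<sigma> k \<noteq> k" for k
    using \<sigma>(1)[of k] \<sigma>(3)[of k] \<sigma>(3)[of "\<sigma> k"] that by metis
  show thesis
  proof
    show "P \<subseteq> {{i, i + 1} | i. 1 \<le> i \<and> i + 1 \<le> n}"
    proof
      fix f assume "f \<in> P"
      then obtain k where k: "f = {k, \<sigma> k}" "\<sigma> k \<noteq> k" by (auto simp: P_def)
      have "\<sigma> k \<le> Suc k" "k \<le> Suc (\<sigma> k)" using \<sigma>(2)[of k] \<sigma>(2)[of "\<sigma> k"] \<sigma>(1)[of k] by auto
      then consider "\<sigma> k = Suc k" | "k = Suc (\<sigma> k)" using k(2) by linarith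
      then show "f \<in> {{i, i + 1} | i. 1 \<le> i \<and> i + 1 \<le> n}"
      proof cases
        case 1
        then show ?thesis using k in_range[of k] by (intro CollectI exI[of _ k]) auto
      next
        case 2
        then have "f = {\<sigma> k, \<sigma> k + 1}" using k(1) by auto
        then show ?thesis using 2 in_range[OF k(2)] by (intro CollectI exI[of _ "\<sigma> k"]) auto
      qed
    qed
    show "{i, j} \<in> P \<longleftrightarrow> i \<in> {1..n} \<and> j = \<sigma> i \<and> i \<noteq> j" for i j
    proof
      assume "{i, j} \<in> P"
      then obtain k where k: "{i, j} = {k, \<sigma> k}" "\<sigma> k \<noteq> k" by (auto simp: P_def)
      then have "j = \<sigma> i \<and> i \<noteq> j" using \<sigma>(1)[of k] by (auto simp: doubleton_eq_iff)
      then show "i \<in> {1..n} \<and> j = \<sigma> i \<and> i \<noteq> j" using in_range[of i] by auto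
    next
      assume "i \<in> {1..n} \<and> j = \<sigma> i \<and> i \<noteq> j"
      then show "{i, j} \<in> P" unfolding P_def by (intro CollectI exI[of _ i]) auto
    qed
    show "k \<in> \<Union>P \<longleftrightarrow> k \<in> {1..n} \<and> \<sigma> k \<noteq> k" for k
    proof
      assume "k \<in> \<Union>P"
      then obtain l where l: "\<sigma> l \<noteq> l" "k = l \<or> k = \<sigma> l" by (auto simp: P_def)
      then have "\<sigma> k \<noteq> k" using \<sigma>(1)[of l] by metis
      then show "k \<in> {1..n} \<and> \<sigma> k \<noteq> k" using in_range[of k] by simp
    qed (auto simp: P_def)
    show "pairwise disjnt P"
    proof (rule pairwiseI)
      fix f g assume "f \<in> P" "g \<in> P" "f \<noteq> g"
      then obtain k l where kl: "f = {k, \<sigma> k}" "g = {l, \<sigma> l}" by (auto simp: P_def)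
      show "disjnt f g"
      proof (rule ccontr)
        assume "\<not> disjnt f g"
        then have "k = l \<or> k = \<sigma> l \<or> \<sigma> k = l \<or> \<sigma> k = \<sigma> l" using kl by (auto simp: disjnt_def)
        then have "k = l \<or> k = \<sigma> l" using \<sigma>(1) by metis
        then have "f = g" using kl \<sigma>(1)[of l] by auto
        then show False using \<open>f \<noteq> g\<close> by simp
      qed
    qed
  qed
qed

lemma involution_of_adjacent_pairs:
  fixes P :: "nat set set"
  assumes P: "P \<subseteq> {{i, i + 1} | i. 1 \<le> i \<and> i + 1 \<le> n}" and disj: "pairwise disjnt P"
  obtains \<sigma> where "\<And>k. \<sigma> (\<sigma> k) = k" "\<And>k. \<sigma> k \<le> Suc k" "\<And>k. k \<notin> {1..n} \<Longrightarrow> \<sigma> k = k"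
    "\<And>i j. {i, j} \<in> P \<longleftrightarrow> i \<in> {1..n} \<and> j = \<sigma> i \<and> i \<noteq> j"
    "\<And>k. k \<in> \<Union>P \<longleftrightarrow> k \<in> {1..n} \<and> \<sigma> k \<noteq> k"
proof -
  have pair: "i \<in> {1..n} \<and> i \<noteq> j \<and> j \<le> Suc i" if ij: "{i, j} \<in> P" for i j
  proof -
    obtain l where "{i, j} = {l, l + 1}" "1 \<le> l" "l + 1 \<le> n" using P ij by blast
    then show ?thesis by (auto simp: doubleton_eq_iff)
  qed
  have uniq: "j = j'" if "{i, j} \<in> P" "{i, j'} \<in> P" for i j j'
  proof -
    have "\<not> disjnt {i, j} {i, j'}" by (auto simp: disjnt_def)
    then have "{i, j} = {i, j'}" using disj that by (meson pairwiseD)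
    then show ?thesis by (auto simp: doubleton_eq_iff)
  qed
  \<comment> \<open>Each index goes to its partner, unique because the pairs are disjoint, and stays
    fixed if it has none.\<close>
  define \<sigma> where "\<sigma> k = (if \<exists>j. {k, j} \<in> P then THE j. {k, j} \<in> P else k)" for k
  have \<sigma>P: "\<sigma> k = j" if "{k, j} \<in> P" for k j
    using that uniq unfolding \<sigma>_def by (auto intro!: the_equality)
  have \<sigma>_id: "\<sigma> k = k" if "\<nexists>j. {k, j} \<in> P" for k using that by (auto simp: \<sigma>_def)
  have ex: "(\<exists>j. {k, j} \<in> P) \<longleftrightarrow> \<sigma> k \<noteq> k" for k using \<sigma>P \<sigma>_id pair by metis
  show thesis
  proof
    show "\<sigma> (\<sigma> k) = k" for k
    proof (cases "\<exists>j. {k, j} \<in> P")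
      case True
      then obtain j where j: "{k, j} \<in> P" by blast
      then have "{j, k} \<in> P" by (simp add: insert_commute)
      then show ?thesis using \<sigma>P j by metis
    qed (simp add: \<sigma>_id)
    show "\<sigma> k \<le> Suc k" for k using \<sigma>P[of k] \<sigma>_id[of k] pair[of k] by (metis le_SucI order_refl)
    show "\<sigma> k = k" if "k \<notin> {1..n}" for k using \<sigma>_id[of k] pair[of k] that by blast
    show "{i, j} \<in> P \<longleftrightarrow> i \<in> {1..n} \<and> j = \<sigma> i \<and> i \<noteq> j" for i j using \<sigma>P ex pair by metis
    show "k \<in> \<Union>P \<longleftrightarrow> k \<in> {1..n} \<and> \<sigma> k \<noteq> k" for k
    proof
      assume "k \<in> \<Union>P"
      then obtain f where f: "f \<in> P" "k \<in> f" by blast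
      then obtain i where "f = {i, i + 1}" using P by blast
      then have "\<exists>j. {k, j} \<in> P" using f by (auto simp: insert_commute)
      then show "k \<in> {1..n} \<and> \<sigma> k \<noteq> k" using ex pair by blast
    qed (use ex[of k] in blast)
  qed
qed

theorem theorem1p4:
  fixes V :: "'a set" and E :: "'a set set" and e :: "'a set" and u\<^sub>1 u\<^sub>2 :: 'a
  assumes "simple_graph V E"
    and "k_connected 3 V E"
    and "e \<in> E"
    and "e = {u\<^sub>1, u\<^sub>2}"
  shows "\<not> (\<exists>C D. is_cycle V E C \<and> is_cycle V E D \<and>
              cycle_edges C \<inter> cycle_edges D = {} \<and> e \<in> cycle_edges C \<union> cycle_edges D)
    \<longleftrightarrow>
    (\<exists>(n::nat) (v :: nat \<Rightarrow> 'a) (w :: nat \<Rightarrow> 'a) \<alpha> \<beta> (P :: nat set set).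
       \<alpha> = u\<^sub>1 # map v [1..<n+1] @ [u\<^sub>2] \<and>
       \<beta> = u\<^sub>1 # map w [1..<n+1] @ [u\<^sub>2] \<and>
       is_path V E u\<^sub>1 \<alpha> u\<^sub>2 \<and>
       is_path V E u\<^sub>1 \<beta> u\<^sub>2 \<and>
       set \<alpha> \<inter> set \<beta> = {u\<^sub>1, u\<^sub>2} \<and>
       e \<notin> path_edges \<alpha> \<and>
       e \<notin> path_edges \<beta> \<and>
       P \<subseteq> {{i, i + 1} | i. 1 \<le> i \<and> i + 1 \<le> n} \<and>
       pairwise disjnt P \<and>
       V = set \<alpha> \<union> set \<beta> \<and>
       E = {{v i, w j} | i j. {i, j} \<in> P} \<union> {{v j, w i} | i j. {i, j} \<in> P}
           \<union> {{v k, w k} | k. k \<in> {1..n} \<and> k \<notin> \<Union>P}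
           \<union> path_edges \<alpha> \<union> path_edges \<beta> \<union> {e})"
    (is "?L \<longleftrightarrow> ?R")
proof
  assume ?L
  then have "no_disjoint_cycles_through V E {u\<^sub>1, u\<^sub>2}"
    by (simp add: no_disjoint_cycles_through_def assms(4))
  then obtain n p q \<sigma> where "ladder_decomposition V E u\<^sub>1 u\<^sub>2 n p q \<sigma>"
    using no_disjoint_cycles_ladder_decomposition[OF assms(1,2)] assms(3,4) by metis
  then have len: "length p = Suc (Suc n)" "length q = Suc (Suc n)"
    and paths: "is_path V E u\<^sub>1 p u\<^sub>2" "is_path V E u\<^sub>1 q u\<^sub>2"
    and L: "set p \<inter> set q = {u\<^sub>1, u\<^sub>2}" "{u\<^sub>1, u\<^sub>2} \<notin> path_edges p" "{u\<^sub>1, u\<^sub>2} \<notin> path_edges q"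
      "V = set p \<union> set q"
    and E: "E = {{p ! k, q ! \<sigma> k} | k. k \<in> {1..n}} \<union> path_edges p \<union> path_edges q \<union> {{u\<^sub>1, u\<^sub>2}}"
    and \<sigma>: "\<And>k. \<sigma> (\<sigma> k) = k" "\<And>k. \<sigma> k \<le> Suc k" "\<And>k. k \<notin> {1..n} \<Longrightarrow> \<sigma> k = k"
    unfolding ladder_decomposition_def by blast+
  \<comment> \<open>List positions serve as the functions \<open>v\<close> and \<open>w\<close>:
    position 0 is \<open>u\<^sub>1\<close> and position \<open>Suc n\<close> is
    \<open>u\<^sub>2\<close>.\<close>
  have list: "r = u\<^sub>1 # map ((!) r) [1..<n+1] @ [u\<^sub>2]"
    if "is_path V E u\<^sub>1 r u\<^sub>2" "length r = Suc (Suc n)" for r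
  proof -
    have "r ! 0 = u\<^sub>1" "r ! Suc n = u\<^sub>2"
      using that by (auto simp: is_path_def hd_conv_nth last_conv_nth)
    then show ?thesis
      using that(2) by (intro nth_equalityI) (auto simp: nth_Cons nth_append less_Suc_eq split: nat.split)
  qed
  obtain P where P: "P \<subseteq> {{i, i + 1} | i. 1 \<le> i \<and> i + 1 \<le> n}" "pairwise disjnt P"
    and P': "\<And>i j. {i, j} \<in> P \<longleftrightarrow> i \<in> {1..n} \<and> j = \<sigma> i \<and> i \<noteq> j"
      "\<And>k. k \<in> \<Union>P \<longleftrightarrow> k \<in> {1..n} \<and> \<sigma> k \<noteq> k"
    using adjacent_pairs_of_involution[OF \<sigma>] by blast
  note E' = E[folded rung_edges_eq[of P n \<sigma> "(!) p" "(!) q", OF P'], folded assms(4)]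
  show ?R
    by (intro exI[of _ n] exI[of _ "(!) p"] exI[of _ "(!) q"] exI[of _ p] exI[of _ q] exI[of _ P] conjI
      list[OF paths(1) len(1)] list[OF paths(2) len(2)] paths L P E' L(2,3)[folded assms(4)])
next
  assume ?R
  then obtain n v w \<alpha> \<beta> P where \<alpha>: "\<alpha> = u\<^sub>1 # map v [1..<n+1] @ [u\<^sub>2]"
    and \<beta>: "\<beta> = u\<^sub>1 # map w [1..<n+1] @ [u\<^sub>2]"
    and L: "is_path V E u\<^sub>1 \<alpha> u\<^sub>2" "is_path V E u\<^sub>1 \<beta> u\<^sub>2" "set \<alpha> \<inter> set \<beta> = {u\<^sub>1, u\<^sub>2}"
       "e \<notin> path_edges \<alpha>" "e \<notin> path_edges \<beta>"
    and P: "P \<subseteq> {{i, i + 1} | i. 1 \<le> i \<and> i + 1 \<le> n}" "pairwise disjnt P"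
    and V: "V = set \<alpha> \<union> set \<beta>"
    and E: "E = {{v i, w j} | i j. {i, j} \<in> P} \<union> {{v j, w i} | i j. {i, j} \<in> P}
           \<union> {{v k, w k} | k. k \<in> {1..n} \<and> k \<notin> \<Union>P}
           \<union> path_edges \<alpha> \<union> path_edges \<beta> \<union> {e}"
    by blast
  obtain \<sigma> where \<sigma>: "\<And>k. \<sigma> (\<sigma> k) = k" "\<And>k. \<sigma> k \<le> Suc k" "\<And>k. k \<notin> {1..n} \<Longrightarrow> \<sigma> k = k"
    and P': "\<And>i j. {i, j} \<in> P \<longleftrightarrow> i \<in> {1..n} \<and> j = \<sigma> i \<and> i \<noteq> j"
      "\<And>k. k \<in> \<Union>P \<longleftrightarrow> k \<in> {1..n} \<and> \<sigma> k \<noteq> k"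
    using involution_of_adjacent_pairs[OF P] by blast
  \<comment> \<open>Because \<open>u\<^sub>1\<close> occupies position 0, labels and positions agree
    on \<open>{1..n}\<close>. Outside that range \<open>v\<close> and \<open>w\<close> are
    arbitrary, so \<open>\<sigma>\<close> must be shown to stay inside it.\<close>
  have nth: "\<alpha> ! k = v k" "\<beta> ! k = w k" if "k \<in> {1..n}" for k
    using that by (cases k; auto simp: \<alpha> \<beta> nth_append simp del: upt_Suc)+
  have \<sigma>n: "\<sigma> k \<in> {1..n}" if "k \<in> {1..n}" for k using \<sigma>(1)[of k] \<sigma>(3)[of "\<sigma> k"] that by metis
  have "{{v k, w (\<sigma> k)} | k. k \<in> {1..n}} = {{\<alpha> ! k, \<beta> ! \<sigma> k} | k. k \<in> {1..n}}"
    using nth \<sigma>n by (intro Collect_cong) metis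
  then have "E = {{\<alpha> ! k, \<beta> ! \<sigma> k} | k. k \<in> {1..n}} \<union> path_edges \<alpha> \<union> path_edges \<beta> \<union> {{u\<^sub>1, u\<^sub>2}}"
    using E rung_edges_eq[of P n \<sigma> v w, OF P'] assms(4) by simp
  moreover have "length \<alpha> = Suc (Suc n)" "length \<beta> = Suc (Suc n)" by (auto simp: \<alpha> \<beta>)
  ultimately have "ladder_decomposition V E u\<^sub>1 u\<^sub>2 n \<alpha> \<beta> \<sigma>"
    unfolding ladder_decomposition_def using L V \<sigma> assms(4) by blast
  moreover have "u\<^sub>1 \<noteq> u\<^sub>2" using assms by (auto simp: simple_graph_def)
  ultimately show ?L
    using ladder_decomposition_no_disjoint_cycles
    unfolding no_disjoint_cycles_through_def assms(4) by metis
qed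

end
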